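(* Let $R\subset S$ be an integral FCP extension of commutative rings. Then there exists a greatest subalgebra $V\in[R,S]$, denoted ${}^\square_SR$, such that $R\subseteq V$ is $\kappa$-separable. Moreover, for any $U\in[R,S]$, the extension $R\subseteq U$ is $\kappa$-separable if and only if $U\in[R,V]$; and any $Z\in[V,S]$ is such that $Z\subseteq S$ is $\kappa$-radicial.
   Context: All rings are commutative and unital; $\subset$ denotes proper inclusion. $[R,S]$ is the set of all $R$-subalgebras of $S$, ordered by inclusion; $R\subseteq S$ has FCP if each chain in $[R,S]$ is finite. For $Q\in\mathrm{Spec}(S)$ the residual extension of $R\subseteq S$ at $Q$ is $\kappa_R(Q\cap R)\to\kappa_S(Q)$, where $\kappa_R(P)=R_P/PR_P$. An integral extension is $\kappa$-separable (resp. $\kappa$-radicial) if all its residual extensions are separable algebraic (resp. purely inseparable) field extensions. *)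

theory Defs
  imports "HOL-Algebra.Finite_Extensions"
begin

section \<open>Ring extensions\<close>

text \<open>
  A ring extension \<open>R \<subseteq> S\<close> is given by a commutative ring \<open>S\<close> and a subset \<open>R\<close> of its carrier
  satisfying \<^term>\<open>subcring R S\<close>; an intermediate ring \<open>U\<close> is a subset too, and as a ring in its own
  right it is \<^term>\<open>S\<lparr>carrier := U\<rparr>\<close>.
\<close>

definition subalgebras :: "'a set \<Rightarrow> ('a, 'b) ring_scheme \<Rightarrow> 'a set set"
  where "subalgebras R S = {T. subcring T S \<and> R \<subseteq> T}"

definition FCP :: "'a set \<Rightarrow> ('a, 'b) ring_scheme \<Rightarrow> bool"
  where "FCP R S \<longleftrightarrow> (\<forall>C. subset.chain (subalgebras R S) C \<longrightarrow> finite C)"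

text \<open>
  Polynomials are coefficient lists, leading coefficient first. The predicate \<^const>\<open>polynomial\<close>
  is avoided below since it has no monic polynomials over the zero ring.
\<close>

definition integral_extension :: "'a set \<Rightarrow> ('a, 'b) ring_scheme \<Rightarrow> bool"
  where "integral_extension R S \<longleftrightarrow>
    (\<forall>x \<in> carrier S. \<exists>p. set p \<subseteq> R \<and> p \<noteq> [] \<and> lead_coeff p = \<one>\<^bsub>S\<^esub> \<and> ring.eval S p x = \<zero>\<^bsub>S\<^esub>)"


section \<open>Separable and purely inseparable field extensions\<close>

definition (in ring) poly_deriv :: "'a list \<Rightarrow> 'a list"
  where "poly_deriv p = normalize (map (\<lambda>i. [i] \<cdot> coeff p i) (rev [1..<length p]))"

definition separable_poly :: "('a, 'b) ring_scheme \<Rightarrow> 'a set \<Rightarrow> 'a list \<Rightarrow> bool"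
  where "separable_poly L K p \<longleftrightarrow>
    \<one>\<^bsub>K[X]\<^bsub>L\<^esub>\<^esub> gcdof\<^bsub>K[X]\<^bsub>L\<^esub>\<^esub> p (ring.poly_deriv L p)"

definition separable_algebraic :: "'a set \<Rightarrow> ('a, 'b) ring_scheme \<Rightarrow> bool"
  where "separable_algebraic K L \<longleftrightarrow>
    (\<forall>x \<in> carrier L. (ring.algebraic L over K) x \<and> separable_poly L K (ring.Irr L K x))"

text \<open>The additive order of \<open>\<one>\<close> is \<open>0\<close> if infinite, so it is the characteristic.\<close>

definition char_exponent :: "('a, 'b) ring_scheme \<Rightarrow> nat"
  where "char_exponent L =
    (let c = group.ord (add_monoid L) \<one>\<^bsub>L\<^esub> in if c = 0 then 1 else c)"

definition purely_inseparable :: "'a set \<Rightarrow> ('a, 'b) ring_scheme \<Rightarrow> bool"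
  where "purely_inseparable K L \<longleftrightarrow>
    (\<forall>x \<in> carrier L. \<exists>n::nat. x [^]\<^bsub>L\<^esub> (char_exponent L ^ n) \<in> K)"


section \<open>Localization at a prime and residue fields\<close>

definition fraction_rel :: "('a, 'b) ring_scheme \<Rightarrow> 'a set \<Rightarrow> (('a \<times> 'a) \<times> ('a \<times> 'a)) set"
  where "fraction_rel R P = {((a, s), (b, t)).
    a \<in> carrier R \<and> b \<in> carrier R \<and> s \<in> carrier R - P \<and> t \<in> carrier R - P \<and>
    (\<exists>u \<in> carrier R - P. u \<otimes>\<^bsub>R\<^esub> (a \<otimes>\<^bsub>R\<^esub> t \<ominus>\<^bsub>R\<^esub> b \<otimes>\<^bsub>R\<^esub> s) = \<zero>\<^bsub>R\<^esub>)}"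

definition fraction :: "('a, 'b) ring_scheme \<Rightarrow> 'a set \<Rightarrow> 'a \<Rightarrow> 'a \<Rightarrow> ('a \<times> 'a) set"
  where "fraction R P a s = fraction_rel R P `` {(a, s)}"

definition localization :: "('a, 'b) ring_scheme \<Rightarrow> 'a set \<Rightarrow> ('a \<times> 'a) set ring"
  where "localization R P =
    \<lparr>carrier = (carrier R \<times> (carrier R - P)) // fraction_rel R P,
     mult = (\<lambda>A B. \<Union>(a, s) \<in> A. \<Union>(b, t) \<in> B.
               fraction R P (a \<otimes>\<^bsub>R\<^esub> b) (s \<otimes>\<^bsub>R\<^esub> t)),
     one = fraction R P \<one>\<^bsub>R\<^esub> \<one>\<^bsub>R\<^esub>,
     zero = fraction R P \<zero>\<^bsub>R\<^esub> \<one>\<^bsub>R\<^esub>,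
     add = (\<lambda>A B. \<Union>(a, s) \<in> A. \<Union>(b, t) \<in> B.
               fraction R P (a \<otimes>\<^bsub>R\<^esub> t \<oplus>\<^bsub>R\<^esub> b \<otimes>\<^bsub>R\<^esub> s) (s \<otimes>\<^bsub>R\<^esub> t))\<rparr>"

definition localized_ideal :: "('a, 'b) ring_scheme \<Rightarrow> 'a set \<Rightarrow> ('a \<times> 'a) set set"
  where "localized_ideal R P = Idl\<^bsub>localization R P\<^esub> ((\<lambda>a. fraction R P a \<one>\<^bsub>R\<^esub>) ` P)"

definition residue_field :: "('a, 'b) ring_scheme \<Rightarrow> 'a set \<Rightarrow> ('a \<times> 'a) set set ring"
  where "residue_field R P = localization R P Quot localized_ideal R P"


section \<open>Residual extensions\<close>

text \<open>
  The map \<open>\<kappa>\<^sub>R(Q \<inter> R) \<rightarrow> \<kappa>\<^sub>S(Q)\<close> induced by the inclusion \<open>R \<subseteq> S\<close>: it sends the residue class of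
  \<open>a/s\<close> to the residue class of \<open>a/s\<close>. The members of \<^term>\<open>\<Union>A\<close> are the pairs \<open>(a, s)\<close> whose
  fraction lies in the residue class \<open>A\<close>, and all of them yield the same class in \<open>\<kappa>\<^sub>S(Q)\<close>.
\<close>

definition residual_map ::
    "('a, 'b) ring_scheme \<Rightarrow> 'a set \<Rightarrow> ('a \<times> 'a) set set \<Rightarrow> ('a \<times> 'a) set set"
  where "residual_map S Q A =
    (\<Union>(a, s) \<in> \<Union>A. localized_ideal S Q +>\<^bsub>localization S Q\<^esub> fraction S Q a s)"

definition residual_subfield :: "'a set \<Rightarrow> ('a, 'b) ring_scheme \<Rightarrow> 'a set \<Rightarrow> ('a \<times> 'a) set set set"
  where "residual_subfield R S Q =
    residual_map S Q ` carrier (residue_field (S\<lparr>carrier := R\<rparr>) (Q \<inter> R))"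

definition kappa_separable :: "'a set \<Rightarrow> ('a, 'b) ring_scheme \<Rightarrow> bool"
  where "kappa_separable R S \<longleftrightarrow> integral_extension R S \<and>
    (\<forall>Q. primeideal Q S \<longrightarrow> separable_algebraic (residual_subfield R S Q) (residue_field S Q))"

definition kappa_radicial :: "'a set \<Rightarrow> ('a, 'b) ring_scheme \<Rightarrow> bool"
  where "kappa_radicial R S \<longleftrightarrow> integral_extension R S \<and>
    (\<forall>Q. primeideal Q S \<longrightarrow> purely_inseparable (residual_subfield R S Q) (residue_field S Q))"

end

theory Submission
  imports Defs "HOL-Computational_Algebra.Primes"
begin

text \<open>
  An element \<open>x\<close> of a field is separable over a subfield \<open>K\<close> iff \<open>f(x) = 0 \<noteq> f'(x)\<close> for some
  \<open>f\<close> over \<open>K\<close>. Clearing denominators, the residue of \<open>x \<in> S\<close> at a prime \<open>Q\<close> is separable over the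
  residue field of \<open>R\<close> iff \<open>f(x) \<in> Q\<close> and \<open>f'(x) \<notin> Q\<close> for some \<open>f\<close> over \<open>R\<close>, a condition that does not
  change when \<open>S\<close> is replaced by an intermediate ring containing \<open>x\<close>. By lying over, the greatest
  \<open>\<kappa>\<close>-separable subalgebra \<open>V\<close> therefore consists of the elements satisfying it at every prime of \<open>S\<close>.

  For \<open>\<kappa>\<close>-radiciality, let \<open>x\<close> be a root of a monic polynomial of degree \<open>d\<close> over \<open>R\<close> and let \<open>p\<close> be the
  characteristic exponent at \<open>Q\<close>. The inseparable degree of \<open>x\<close> at any prime is at most \<open>d\<close>, so \<open>x\<close> is
  separable at primes of residue characteristic \<open>0\<close> or greater than \<open>d\<close>, and \<open>x ^ (p ^ d)\<close> is
  separable at primes of residue characteristic \<open>p\<close>. Hence \<open>s x ^ (p ^ d) \<in> V\<close>, where \<open>s\<close> is the product of the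
  integers up to \<open>d\<close> that are prime to \<open>p\<close>, and \<open>s\<close> is invertible in the residue field at \<open>Q\<close>.
\<close>

section \<open>Formal derivatives\<close>

text \<open>The simple-root criterion mentions neither minimal polynomials nor degrees, so it
  survives enlarging the base, reduction modulo a prime and clearing denominators. The price is that
  closure of the separable elements under sums and products, and hence that V is a ring at all, is
  not evident from it. This is settled in the residue fields without counting embeddings. Let x, y
  be separable over K and z in K(x, y), in characteristic p. Over E = K(z^p), adjoining x and y
  creates no new p-th roots, so z lies in E; then z = f(z^p) for some f, and X - f(X^p), whose
  derivative is 1, shows that z is separable. The integer s repairs a mismatch: radiciality is
  tested at one prime Q, whereas membership in V is a condition at all primes, whose residue
  characteristics may differ. At a prime whose positive residue characteristic is at most d and
  different from p, no power of p need make x separable; but s vanishes in that residue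
  field.\<close>

context ring
begin

lemma coeff_poly_deriv:
  assumes "set p \<subseteq> carrier R"
  shows "coeff (poly_deriv p) i = [Suc i] \<cdot> coeff p (Suc i)"
proof -
  let ?q = "map (\<lambda>i. [i] \<cdot> coeff p i) (rev [1..<length p])"
  have "coeff (poly_deriv p) i = coeff ?q i"
    unfolding poly_deriv_def by (simp add: normalize_coeff[symmetric])
  also have "\<dots> = [Suc i] \<cdot> coeff p (Suc i)"
  proof (cases "i < length p - 1")
    case True
    then have "coeff ?q i = ?q ! (length p - 1 - 1 - i)"
      by (simp add: coeff_nth)
    also have "\<dots> = [Suc i] \<cdot> coeff p (Suc i)"
    proof -
      have "rev [1..<length p] ! (length p - 1 - 1 - i) = Suc i"
        using True by (subst rev_nth) auto
      then show ?thesis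
        using True nth_map[of "length p - 1 - 1 - i" "rev [1..<length p]" "\<lambda>i. [i] \<cdot> coeff p i"]
        by auto
    qed
    finally show ?thesis .
  next
    case False
    then have "coeff ?q i = \<zero>" "coeff p (Suc i) = \<zero>"
      by (auto intro!: coeff_length)
    then show ?thesis by simp
  qed
  finally show ?thesis .
qed

lemma poly_deriv_polynomial:
  assumes "subring K R" "set p \<subseteq> K"
  shows "polynomial K (poly_deriv p)"
proof -
  have "coeff p i \<in> set p \<union> {\<zero>}" for i
    unfolding coeff_img(3)[of p, symmetric] by simp
  then have "coeff p i \<in> K" for i
    using assms(2) subringE(2)[OF assms(1)] by (metis Un_iff empty_iff insert_iff subset_iff)
  moreover have "[(n::nat)] \<cdot> k \<in> K" if "k \<in> K" for n k
    using that subringE(2,7)[OF assms(1)] by (induction n) auto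
  ultimately show ?thesis
    unfolding poly_deriv_def by (intro normalize_gives_polynomial) auto
qed

lemma poly_deriv_closed:
  assumes "subring K R" "p \<in> carrier (K[X])"
  shows "poly_deriv p \<in> carrier (K[X])"
  using poly_deriv_polynomial[OF assms(1)] polynomial_incl assms(2)
  by (simp flip: univ_poly_carrier)

text \<open>Lets witnesses of separability be lists with leading zeros: moving them into
  \<open>K[X]\<close> keeps the derivative.\<close>

lemma poly_deriv_normalize:
  assumes "set p \<subseteq> carrier R"
  shows "poly_deriv (normalize p) = poly_deriv p"
proof -
  have "polynomial (carrier R) (poly_deriv (normalize p))" "polynomial (carrier R) (poly_deriv p)"
    using assms by (auto intro!: poly_deriv_polynomial carrier_is_subring dest: normalize_in_carrier)
  moreover have "coeff (poly_deriv (normalize p)) = coeff (poly_deriv p)"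
    by (rule ext) (simp add: coeff_poly_deriv assms normalize_in_carrier normalize_coeff[symmetric])
  ultimately show ?thesis
    using coeff_iff_polynomial_cond by blast
qed

lemma poly_deriv_add:
  assumes "set p \<subseteq> carrier R" "set q \<subseteq> carrier R"
  shows "poly_deriv (poly_add p q) = poly_add (poly_deriv p) (poly_deriv q)"
proof -
  have D: "polynomial (carrier R) (poly_deriv r)" "set (poly_deriv r) \<subseteq> carrier R"
    if "set r \<subseteq> carrier R" for r
    using poly_deriv_polynomial[OF carrier_is_subring that] polynomial_incl by auto
  have "coeff (poly_deriv (poly_add p q)) = coeff (poly_add (poly_deriv p) (poly_deriv q))"
    by (rule ext)
      (simp del: poly_add.simps add.nat_pow_Suc add: coeff_poly_deriv assms poly_add_in_carrier poly_add_coeff D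
        add.nat_pow_distrib)
  then show ?thesis
    using coeff_iff_polynomial_cond[OF D(1)[OF poly_add_in_carrier[OF assms]]
        poly_add_is_polynomial[OF carrier_is_subring D(2)[OF assms(1)] D(2)[OF assms(2)]]]
    by blast
qed

end

lemma (in ring) add_pow_finsum:
  fixes n :: nat
  assumes "finite A" "f \<in> A \<rightarrow> carrier R"
  shows "[n] \<cdot> (\<Oplus>a\<in>A. f a) = (\<Oplus>a\<in>A. [n] \<cdot> f a)"
  using assms by (induction A rule: finite_induct) (auto simp: add.nat_pow_distrib Pi_def)

text \<open>In the convolution for the coefficient of index \<open>Suc i\<close>, the weight
  \<open>Suc i\<close> of each term splits as \<open>k + (Suc i - k)\<close>; the two parts belong
  to the two products of the Leibniz rule.\<close>

lemma (in cring) poly_deriv_mult: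
  assumes "set p \<subseteq> carrier R" "set q \<subseteq> carrier R"
  shows "poly_deriv (poly_mult p q) =
    poly_add (poly_mult (poly_deriv p) q) (poly_mult p (poly_deriv q))"
proof -
  have D: "polynomial (carrier R) (poly_deriv r)" "set (poly_deriv r) \<subseteq> carrier R"
    if "set r \<subseteq> carrier R" for r
    using poly_deriv_polynomial[OF carrier_is_subring that] polynomial_incl by auto
  have c: "coeff p k \<in> carrier R" "coeff q k \<in> carrier R" for k
    using assms by auto
  have "coeff (poly_deriv (poly_mult p q)) i =
    coeff (poly_add (poly_mult (poly_deriv p) q) (poly_mult p (poly_deriv q))) i" for i
  proof -
    let ?t = "\<lambda>k. coeff p k \<otimes> coeff q (Suc i - k)"
    have split: "[Suc i] \<cdot> ?t k = [k] \<cdot> ?t k \<oplus> [(Suc i - k)] \<cdot> ?t k" if "k \<le> Suc i" for k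
      using add.nat_pow_mult[of "?t k" k "Suc i - k"] c that by simp
    have "coeff (poly_deriv (poly_mult p q)) i = [Suc i] \<cdot> (\<Oplus>k\<in>{..Suc i}. ?t k)"
      by (simp del: poly_mult.simps finsum_Suc add.nat_pow_Suc
          add: coeff_poly_deriv poly_mult_in_carrier assms poly_mult_coeff)
    also have "\<dots> = (\<Oplus>k\<in>{..Suc i}. [Suc i] \<cdot> ?t k)"
      using c by (intro add_pow_finsum) auto
    also have "\<dots> = (\<Oplus>k\<in>{..Suc i}. [k] \<cdot> ?t k \<oplus> [(Suc i - k)] \<cdot> ?t k)"
      using c by (intro add.finprod_cong') (auto simp: split simp del: add.nat_pow_Suc)
    also have "\<dots> = (\<Oplus>k\<in>{..Suc i}. [k] \<cdot> ?t k) \<oplus> (\<Oplus>k\<in>{..Suc i}. [(Suc i - k)] \<cdot> ?t k)"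
      using c by (intro finsum_addf) auto
    \<comment> \<open>The weight kills the term k = 0 of this sum, which permits the index shift,
      and the term k = \<open>Suc i\<close> of the next one.\<close>
    also have "(\<Oplus>k\<in>{..Suc i}. [k] \<cdot> ?t k) = (\<Oplus>k\<in>{..i}. [Suc k] \<cdot> ?t (Suc k))"
      using c by (subst finsum_Suc2) (auto simp del: add.nat_pow_Suc)
    also have "(\<Oplus>k\<in>{..Suc i}. [(Suc i - k)] \<cdot> ?t k) = (\<Oplus>k\<in>{..i}. [(Suc i - k)] \<cdot> ?t k)"
      using c by (subst finsum_Suc) (auto simp del: add.nat_pow_Suc)
    also have "(\<Oplus>k\<in>{..i}. [Suc k] \<cdot> ?t (Suc k)) =
        (\<Oplus>k\<in>{..i}. coeff (poly_deriv p) k \<otimes> coeff q (i - k))"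
      using c by (intro add.finprod_cong')
        (auto simp del: add.nat_pow_Suc simp: coeff_poly_deriv assms add_pow_ldistr)
    also have "(\<Oplus>k\<in>{..i}. [(Suc i - k)] \<cdot> ?t k) =
        (\<Oplus>k\<in>{..i}. coeff p k \<otimes> coeff (poly_deriv q) (i - k))"
      using c by (intro add.finprod_cong')
        (auto simp del: add.nat_pow_Suc simp: coeff_poly_deriv assms add_pow_rdistr Suc_diff_le)
    finally show ?thesis
      by (simp del: poly_mult.simps poly_add.simps
          add: poly_add_coeff poly_mult_coeff poly_mult_in_carrier assms D)
  qed
  then show ?thesis
    using coeff_iff_polynomial_cond[OF D(1)[OF poly_mult_in_carrier[OF assms]]
        poly_add_is_polynomial[OF carrier_is_subring
          poly_mult_in_carrier[OF D(2)[OF assms(1)] assms(2)]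
          poly_mult_in_carrier[OF assms(1) D(2)[OF assms(2)]]]]
    by blast
qed

section \<open>Separable elements\<close>

text \<open>A simple root of some \<open>f\<close>, which need be neither irreducible nor
  normalized: leading zeros are harmless and arise when coefficients are mapped to another
  ring.\<close>

definition (in ring) separable_over :: "'a set \<Rightarrow> 'a \<Rightarrow> bool"
  where "separable_over K x \<longleftrightarrow>
    (\<exists>f. set f \<subseteq> K \<and> eval f x = \<zero> \<and> eval (poly_deriv f) x \<noteq> \<zero>)"

lemma (in ring) separable_over_mono:
  "separable_over K x \<Longrightarrow> K \<subseteq> K' \<Longrightarrow> separable_over K' x"
  unfolding separable_over_def by blast

lemma (in ring) separable_overE:
  assumes "separable_over K x" "K \<subseteq> carrier R" "x \<in> carrier R"
  obtains f where "f \<in> carrier (K[X])" "eval f x = \<zero>" "eval (poly_deriv f) x \<noteq> \<zero>"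
proof -
  obtain f where f: "set f \<subseteq> K" "eval f x = \<zero>" "eval (poly_deriv f) x \<noteq> \<zero>"
    using assms(1) unfolding separable_over_def by blast
  have "set f \<subseteq> carrier R"
    using f(1) assms(2) by blast
  then show thesis
    using that[of "normalize f"] f assms(3) normalize_gives_polynomial[OF f(1)]
    by (simp add: poly_deriv_normalize eval_normalize flip: univ_poly_carrier)
qed

section \<open>Derivatives in the polynomial ring over a subring of a domain\<close>

context domain
begin

context
  fixes K assumes K: "subring K R"
begin

interpretation UP: domain "K[X]"
  using univ_poly_is_domain[OF K] .

lemma poly_in_carrier: "p \<in> carrier (K[X]) \<Longrightarrow> set p \<subseteq> carrier R"
  using polynomial_in_carrier[OF K] by (simp add: univ_poly_carrier)

lemma poly_deriv_univ_poly_add: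
  "\<lbrakk>p \<in> carrier (K[X]); q \<in> carrier (K[X])\<rbrakk> \<Longrightarrow>
    poly_deriv (p \<oplus>\<^bsub>K[X]\<^esub> q) = poly_deriv p \<oplus>\<^bsub>K[X]\<^esub> poly_deriv q"
  unfolding univ_poly_add by (simp del: poly_add.simps add: poly_deriv_add poly_in_carrier)

lemma poly_deriv_univ_poly_mult:
  "\<lbrakk>p \<in> carrier (K[X]); q \<in> carrier (K[X])\<rbrakk> \<Longrightarrow>
    poly_deriv (p \<otimes>\<^bsub>K[X]\<^esub> q) =
      poly_deriv p \<otimes>\<^bsub>K[X]\<^esub> q \<oplus>\<^bsub>K[X]\<^esub> p \<otimes>\<^bsub>K[X]\<^esub> poly_deriv q"
  unfolding univ_poly_add univ_poly_mult by (simp del: poly_add.simps add: poly_deriv_mult poly_in_carrier)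

lemma poly_deriv_const: "poly_deriv [k] = []"
  unfolding poly_deriv_def by simp

lemma poly_deriv_zero: "poly_deriv [] = []"
  unfolding poly_deriv_def by simp

lemma poly_deriv_univ_poly_a_inv:
  assumes "p \<in> carrier (K[X])"
  shows "poly_deriv (\<ominus>\<^bsub>K[X]\<^esub> p) = \<ominus>\<^bsub>K[X]\<^esub> poly_deriv p"
proof -
  have "poly_deriv (\<ominus>\<^bsub>K[X]\<^esub> p) \<oplus>\<^bsub>K[X]\<^esub> poly_deriv p = \<zero>\<^bsub>K[X]\<^esub>"
    using poly_deriv_univ_poly_add[of "\<ominus>\<^bsub>K[X]\<^esub> p" p] assms
    by (simp add: UP.l_neg) (simp add: univ_poly_zero poly_deriv_zero)
  then show ?thesis
    using UP.minus_equality poly_deriv_closed[OF K] assms by (metis UP.add.inv_closed)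
qed

lemma poly_deriv_univ_poly_pow:
  assumes "p \<in> carrier (K[X])"
  shows "poly_deriv (p [^]\<^bsub>K[X]\<^esub> Suc n) = [Suc n] \<cdot>\<^bsub>K[X]\<^esub> (p [^]\<^bsub>K[X]\<^esub> n \<otimes>\<^bsub>K[X]\<^esub> poly_deriv p)"
proof (induction n)
  case 0
  then show ?case using assms poly_deriv_closed[OF K] by simp
next
  case (Suc n)
  let ?D = "poly_deriv p" and ?q = "p [^]\<^bsub>K[X]\<^esub> n"
  have c: "?D \<in> carrier (K[X])" "?q \<in> carrier (K[X])"
    using assms poly_deriv_closed[OF K] by auto
  have "poly_deriv (p [^]\<^bsub>K[X]\<^esub> Suc (Suc n)) =
    [Suc n] \<cdot>\<^bsub>K[X]\<^esub> (?q \<otimes>\<^bsub>K[X]\<^esub> ?D) \<otimes>\<^bsub>K[X]\<^esub> p \<oplus>\<^bsub>K[X]\<^esub> p [^]\<^bsub>K[X]\<^esub> Suc n \<otimes>\<^bsub>K[X]\<^esub> ?D"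
    using poly_deriv_univ_poly_mult[of "p [^]\<^bsub>K[X]\<^esub> Suc n" p] assms Suc
    by (metis UP.nat_pow_Suc UP.nat_pow_closed)
  also have "[Suc n] \<cdot>\<^bsub>K[X]\<^esub> (?q \<otimes>\<^bsub>K[X]\<^esub> ?D) \<otimes>\<^bsub>K[X]\<^esub> p =
      [Suc n] \<cdot>\<^bsub>K[X]\<^esub> (p [^]\<^bsub>K[X]\<^esub> Suc n \<otimes>\<^bsub>K[X]\<^esub> ?D)"
    using assms c by (simp del: UP.add.nat_pow_Suc add: UP.add_pow_ldistr UP.add_pow_rdistr UP.m_ac)
  finally show ?case
    using assms c by simp
qed

lemma poly_deriv_var: "poly_deriv X = \<one>\<^bsub>K[X]\<^esub>"
  unfolding poly_deriv_def var_def univ_poly_one by simp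

end

end

section \<open>The characteristic of a domain\<close>

lemma (in ring) add_pow_one_eq_zero_iff:
  "[(n::nat)] \<cdot> \<one> = \<zero> \<longleftrightarrow> group.ord (add_monoid R) \<one> dvd n"
  using add.pow_eq_id[of \<one> n] by simp

lemma (in ring) add_pow_eq_mult:
  "x \<in> carrier R \<Longrightarrow> [(n::nat)] \<cdot> x = [n] \<cdot> \<one> \<otimes> x"
  by (simp add: add_pow_ldistr)

lemma (in domain) add_pow_characteristic_univ_poly:
  assumes K: "subring K R" and r: "r \<in> carrier (K[X])" and p: "p = group.ord (add_monoid R) \<one>"
  shows "[p] \<cdot>\<^bsub>K[X]\<^esub> r = \<zero>\<^bsub>K[X]\<^esub>"
proof -
  interpret UP: domain "K[X]"
    using univ_poly_is_domain[OF K] .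
  interpret c: ring_hom_ring "R\<lparr>carrier := K\<rparr>" "K[X]" poly_of_const
    using canonical_embedding_ring_hom[OF K] .
  have "poly_of_const ([n] \<cdot> \<one>) = [n] \<cdot>\<^bsub>K[X]\<^esub> \<one>\<^bsub>K[X]\<^esub> \<and> [n] \<cdot> \<one> \<in> K" for n :: nat
  proof (induction n)
    case 0
    then show ?case using subringE[OF K] by (simp add: univ_poly_zero poly_of_const_def)
  next
    case (Suc n)
    then show ?case
      using c.hom_add[of "[n] \<cdot> \<one>" \<one>] c.hom_one subringE(3,7)[OF K] by simp
  qed
  then have "[p] \<cdot>\<^bsub>K[X]\<^esub> \<one>\<^bsub>K[X]\<^esub> = poly_of_const ([p] \<cdot> \<one>)"
    by simp
  also have "\<dots> = \<zero>\<^bsub>K[X]\<^esub>"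
    using add_pow_one_eq_zero_iff[of p] p by (simp add: univ_poly_zero poly_of_const_def)
  finally show ?thesis
    using UP.add_pow_eq_mult[OF r, of p] r by simp
qed

lemma (in domain) characteristic_cases:
  obtains "group.ord (add_monoid R) \<one> = 0" | "Factorial_Ring.prime (group.ord (add_monoid R) \<one>)"
proof -
  let ?c = "group.ord (add_monoid R) \<one>"
  have "Factorial_Ring.prime ?c" if "?c \<noteq> 0"
  proof (rule prime_natI)
    have "?c \<noteq> 1"
      using add_pow_one_eq_zero_iff[of 1] by auto
    then show "?c \<ge> 2"
      using that by linarith
  next
    fix m n assume mn: "?c dvd m * n"
    have "[m] \<cdot> \<one> \<otimes> [n] \<cdot> \<one> = [(m * n)] \<cdot> \<one>"
      by (simp add: add.nat_pow_pow mult.commute flip: add_pow_eq_mult)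
    also have "\<dots> = \<zero>"
      using mn add_pow_one_eq_zero_iff by blast
    finally show "?c dvd m \<or> ?c dvd n"
      using integral add_pow_one_eq_zero_iff by (metis add.nat_pow_closed one_closed)
  qed
  then show thesis using that by blast
qed

section \<open>Minimal polynomials of separable elements and p-th roots\<close>

context field
begin

context
  fixes K assumes K: "subfield K R"
begin

interpretation UP: principal_domain "K[X]"
  using univ_poly_is_principal[OF K] .

lemma separable_over_algebraic:
  assumes "separable_over K x" "x \<in> carrier R"
  shows "(algebraic over K) x"
proof -
  obtain f where f: "f \<in> carrier (K[X])" "eval f x = \<zero>" "eval (poly_deriv f) x \<noteq> \<zero>"
    using separable_overE[OF assms(1) subfieldE(3)[OF K] assms(2)] .
  then show ?thesis
    by (intro algebraicI[of f]) (auto simp: poly_deriv_def)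
qed

text \<open>Write f = m h with m = \<open>Irr K x\<close>. Since m(x) = 0, the Leibniz rule gives
  f'(x) = m'(x) h(x), so m'(x) = 0 would force f'(x) = 0.\<close>

lemma separable_over_Irr:
  assumes "separable_over K x" "x \<in> carrier R"
  shows "eval (poly_deriv (Irr K x)) x \<noteq> \<zero>"
proof
  assume 0: "eval (poly_deriv (Irr K x)) x = \<zero>"
  obtain f where f: "f \<in> carrier (K[X])" "eval f x = \<zero>" "eval (poly_deriv f) x \<noteq> \<zero>"
    using separable_overE[OF assms(1) subfieldE(3)[OF K] assms(2)] .
  note alg = separable_over_algebraic[OF assms]
  note Irr = IrrE[OF K assms(2) alg]
  interpret ev: ring_hom_ring "K[X]" R "\<lambda>p. eval p x"
    using eval_ring_hom[OF subfieldE(1)[OF K] assms(2)] .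
  obtain h where h: "h \<in> carrier (K[X])" "f = Irr K x \<otimes>\<^bsub>K[X]\<^esub> h"
    using Irr_minimal[OF K assms(2) alg f(1,2)] pdivides_iff_shell[OF K Irr(1) f(1)]
    unfolding factor_def by blast
  have "eval (poly_deriv f) x = \<zero>"
    using h Irr 0 poly_deriv_closed[OF subfieldE(1)[OF K]]
    by (simp add: poly_deriv_univ_poly_mult[OF subfieldE(1)[OF K]])
  with f(3) show False ..
qed

text \<open>Write h = m^j q with j > 0. Cancelling m^(j-1) in h' = 0 leaves j m' q + m q' = 0; at x
  this reads j m'(x) q(x) = 0. As j and m'(x) are nonzero in the field, q(x) = 0, and m divides q
  once more.\<close>

lemma Irr_pow_divides:
  assumes x: "x \<in> carrier R" "separable_over K x"
    and h: "h \<in> carrier (K[X])" "eval h x = \<zero>" "poly_deriv h = []"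
    and j: "\<And>i. 0 < i \<Longrightarrow> i < j \<Longrightarrow> [(i::nat)] \<cdot> \<one> \<noteq> \<zero>"
  shows "Irr K x [^]\<^bsub>K[X]\<^esub> j divides\<^bsub>K[X]\<^esub> h"
  using j
proof (induction j)
  case 0
  then show ?case using h by (simp add: factor_def)
next
  case (Suc j)
  let ?m = "Irr K x"
  note alg = separable_over_algebraic[OF x(2,1)]
  note Irr = IrrE[OF K x(1) alg]
  note D = poly_deriv_closed[OF subfieldE(1)[OF K]]
  interpret ev: ring_hom_ring "K[X]" R "\<lambda>p. eval p x"
    using eval_ring_hom[OF subfieldE(1)[OF K] x(1)] .
  have root: "?m divides\<^bsub>K[X]\<^esub> q" if "q \<in> carrier (K[X])" "eval q x = \<zero>" for q
    using Irr_minimal[OF K x(1) alg that] pdivides_iff_shell[OF K Irr(1) that(1)] by blast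
  show ?case
  proof (cases j)
    case 0
    then show ?thesis using root[OF h(1,2)] Irr by simp
  next
    case (Suc i)
    obtain q where q: "q \<in> carrier (K[X])" "h = ?m [^]\<^bsub>K[X]\<^esub> j \<otimes>\<^bsub>K[X]\<^esub> q"
      using Suc.IH Suc.prems unfolding factor_def by auto
    \<comment> \<open>The cofactor that remains when m^i, with j = i + 1, is taken out of the
      derivative of m^j q.\<close>
    let ?w = "[j] \<cdot>\<^bsub>K[X]\<^esub> (poly_deriv ?m \<otimes>\<^bsub>K[X]\<^esub> q) \<oplus>\<^bsub>K[X]\<^esub> ?m \<otimes>\<^bsub>K[X]\<^esub> poly_deriv q"
    have mi: "?m [^]\<^bsub>K[X]\<^esub> i \<in> carrier (K[X])"
      using Irr by simp
    note cs = mi D[OF Irr(1)] D[OF q(1)] q(1) Irr(1)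
    have "\<zero>\<^bsub>K[X]\<^esub> = poly_deriv h"
      using h by (simp add: univ_poly_zero)
    also have "\<dots> = [j] \<cdot>\<^bsub>K[X]\<^esub> (?m [^]\<^bsub>K[X]\<^esub> i \<otimes>\<^bsub>K[X]\<^esub> poly_deriv ?m) \<otimes>\<^bsub>K[X]\<^esub> q
        \<oplus>\<^bsub>K[X]\<^esub> ?m [^]\<^bsub>K[X]\<^esub> j \<otimes>\<^bsub>K[X]\<^esub> poly_deriv q"
      using q Irr(1) poly_deriv_univ_poly_pow[OF subfieldE(1)[OF K] Irr(1), of i] Suc
      by (simp del: UP.nat_pow_Suc UP.add.nat_pow_Suc
          add: poly_deriv_univ_poly_mult[OF subfieldE(1)[OF K]])
    also have "\<dots> = ?m [^]\<^bsub>K[X]\<^esub> i \<otimes>\<^bsub>K[X]\<^esub> ?w"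
      using cs Suc by (simp del: UP.add.nat_pow_Suc add: UP.add_pow_ldistr UP.add_pow_rdistr UP.m_ac UP.r_distr)
    finally have "?m [^]\<^bsub>K[X]\<^esub> i \<otimes>\<^bsub>K[X]\<^esub> ?w = \<zero>\<^bsub>K[X]\<^esub>" ..
    moreover have "?m [^]\<^bsub>K[X]\<^esub> i \<noteq> \<zero>\<^bsub>K[X]\<^esub>"
      using subring_polynomial_pow_not_zero[OF subfieldE(1)[OF K] Irr(1)]
        pirreducibleE(1)[OF subfieldE(1)[OF K] Irr(1,2)] by (simp add: univ_poly_zero)
    ultimately have "?w = \<zero>\<^bsub>K[X]\<^esub>"
      using UP.integral_iff[of "?m [^]\<^bsub>K[X]\<^esub> i" ?w] cs by simp
    then have "eval ?w x = \<zero>"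
      by (simp add: univ_poly_zero)
    then have "eval ([j] \<cdot>\<^bsub>K[X]\<^esub> (poly_deriv ?m \<otimes>\<^bsub>K[X]\<^esub> q)) x = \<zero>"
      using cs Irr(4) by (simp del: UP.add.nat_pow_Suc)
    moreover have "eval ([n] \<cdot>\<^bsub>K[X]\<^esub> r) x = [n] \<cdot> eval r x" if "r \<in> carrier (K[X])" for n :: nat and r
      using that by (induction n) auto
    ultimately have "[j] \<cdot> (eval (poly_deriv ?m) x \<otimes> eval q x) = \<zero>"
      using cs by simp
    then have "[j] \<cdot> \<one> \<otimes> (eval (poly_deriv ?m) x \<otimes> eval q x) = \<zero>"
      using cs by (subst (asm) add_pow_eq_mult) auto
    moreover have "[j] \<cdot> \<one> \<noteq> \<zero>"
      using Suc.prems[of j] Suc by simp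
    moreover have "eval (poly_deriv ?m) x \<noteq> \<zero>"
      using separable_over_Irr x by simp
    ultimately have "eval q x = \<zero>"
      using integral_iff cs by (metis add.nat_pow_closed ev.hom_closed m_closed one_closed)
    then obtain r where r: "r \<in> carrier (K[X])" "q = ?m \<otimes>\<^bsub>K[X]\<^esub> r"
      using root[OF q(1)] unfolding factor_def by blast
    then have "h = ?m [^]\<^bsub>K[X]\<^esub> Suc j \<otimes>\<^bsub>K[X]\<^esub> r"
      using q cs by (simp add: UP.m_assoc)
    then show ?thesis
      using r(1) unfolding factor_def by blast
  qed
qed

text \<open>A separable extension contains no new \<open>p\<close>-th root: if \<open>z = g(x)\<close> with \<open>deg g < deg (Irr K x)\<close>,
  then \<open>g ^ p - z ^ p\<close> has zero derivative, so it is divisible by \<open>Irr K x ^ p\<close>, hence zero.\<close>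

lemma simple_extension_separable_pth_root:
  assumes x: "x \<in> carrier R" "separable_over K x" and z: "z \<in> simple_extension K x"
    and p: "p = group.ord (add_monoid R) \<one>" "p \<noteq> 0" and zp: "z [^] p \<in> K"
  shows "z \<in> K"
proof -
  let ?m = "Irr K x"
  note K' = subfieldE(1)[OF K]
  note alg = separable_over_algebraic[OF x(2,1)]
  note Irr = IrrE[OF K x(1) alg]
  interpret ev: ring_hom_ring "K[X]" R "\<lambda>p. eval p x"
    using eval_ring_hom[OF K' x(1)] .
  obtain g0 where g0: "g0 \<in> carrier (K[X])" "eval g0 x = z"
    using z simple_extension_as_eval_img[OF subfieldE(3)[OF K] x(1)] by auto
  define g where "g = g0 pmod ?m"
  have m0: "?m \<noteq> []"
    using pirreducibleE(1)[OF K' Irr(1,2)] .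
  have g: "g \<in> carrier (K[X])"
    using long_division_closed(2)[OF K g0(1) Irr(1)] by (simp add: g_def)
  have gdeg: "g = [] \<or> degree g < degree ?m"
    using pmod_degree[OF K g0(1) Irr(1) m0] by (simp add: g_def)
  have "eval g0 x = eval g x"
    using pdiv_pmod[OF K g0(1) Irr(1)] long_division_closed[OF K g0(1) Irr(1)] Irr
    by (metis ev.hom_add ev.hom_mult ev.hom_closed UP.m_closed g_def l_null l_zero)
  then have gz: "eval g x = z"
    using g0 by simp
  define c where "c = poly_of_const (z [^] p)"
  have c: "c \<in> carrier (K[X])" "degree c = 0" "poly_deriv c = []" "eval c x = z [^] p"
  proof -
    show "c \<in> carrier (K[X])" "degree c = 0"
      using poly_of_const_over_subfield[OF K] zp unfolding c_def by blast+
    show "poly_deriv c = []" "eval c x = z [^] p"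
      using zp subfieldE(3)[OF K] x(1) unfolding c_def poly_of_const_def by (auto simp: poly_deriv_def)
  qed
  define h where "h = g [^]\<^bsub>K[X]\<^esub> p \<ominus>\<^bsub>K[X]\<^esub> c"
  have gp: "g [^]\<^bsub>K[X]\<^esub> p \<in> carrier (K[X])"
    using g by simp
  have h: "h \<in> carrier (K[X])"
    using gp c by (simp add: h_def)
  have "eval (g [^]\<^bsub>K[X]\<^esub> p) x = z [^] p"
    using g gz by (simp add: ev.hom_nat_pow)
  then have hx: "eval h x = \<zero>"
    using gp c gz ev.hom_closed[OF g] by (simp add: h_def UP.minus_eq r_neg)
  obtain p' where p': "p = Suc p'"
    using p(2) not0_implies_Suc by blast
  note charpoly = add_pow_characteristic_univ_poly[OF K' _ p(1)]
  have "poly_deriv (g [^]\<^bsub>K[X]\<^esub> p) = \<zero>\<^bsub>K[X]\<^esub>"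
    using poly_deriv_univ_poly_pow[OF K' g, of p'] charpoly poly_deriv_closed[OF K' g] g
    by (simp del: UP.nat_pow_Suc UP.add.nat_pow_Suc flip: p')
  then have hD: "poly_deriv h = []"
    using gp c poly_deriv_univ_poly_add[OF K' gp, of "\<ominus>\<^bsub>K[X]\<^esub> c"] poly_deriv_univ_poly_a_inv[OF K' c(1)]
    by (simp add: h_def UP.minus_eq) (metis UP.minus_zero UP.l_zero UP.zero_closed univ_poly_zero)
  have "?m [^]\<^bsub>K[X]\<^esub> p divides\<^bsub>K[X]\<^esub> h"
    using Irr_pow_divides[OF x h hx hD, of p] add_pow_one_eq_zero_iff p by (simp add: nat_dvd_not_less)
  moreover have mp: "?m [^]\<^bsub>K[X]\<^esub> p \<in> carrier (K[X])"
    using Irr by simp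
  ultimately have *: "h = [] \<or> p * degree ?m \<le> degree h"
    using pdivides_imp_degree_le[OF K' mp h] pdivides_iff_shell[OF K mp h]
      subring_polynomial_pow_degree[OF K' Irr(1)] by metis
  \<comment> \<open>\<open>degree\<close> of the empty list is 0, so this bound is what covers g = 0
    in the strict inequality below.\<close>
  have deg1: "degree ?m \<ge> 1"
    using pirreducible_degree[OF K Irr(1,2)] .
  have "degree h \<le> max (degree (g [^]\<^bsub>K[X]\<^esub> p)) (degree (\<ominus>\<^bsub>K[X]\<^esub> c))"
    unfolding h_def UP.minus_eq by (subst univ_poly_add) (rule poly_add_degree)
  also have "\<dots> = p * degree g"
    using subring_polynomial_pow_degree[OF K' g] univ_poly_a_inv_degree[OF K' c(1)] c(2) by simp
  also have "p * degree g < p * degree ?m"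
    using gdeg deg1 p(2) by auto
  finally have "h = []"
    using * by auto
  then have "g [^]\<^bsub>K[X]\<^esub> p = c"
    using gp c UP.r_right_minus_eq by (simp add: h_def univ_poly_zero)
  \<comment> \<open>Only a constant g has a constant p-th power, and a constant g takes its value z
    in \<open>K\<close>.\<close>
  then have "p * degree g = 0"
    using subring_polynomial_pow_degree[OF K' g] c(2) by metis
  then have "degree g = 0"
    using p(2) by simp
  then obtain k where "k \<in> K" "g = poly_of_const k"
    using poly_of_const_over_subfield[OF K] g by (metis (mono_tags, lifting) imageE mem_Collect_eq)
  then show ?thesis
    using gz x(1) subfieldE(3)[OF K] unfolding poly_of_const_def by (auto split: if_splits)
qed

end

end

section \<open>Criteria for separability, and polynomials with zero derivative\<close>

lemma (in ring) length_poly_deriv: "length (poly_deriv p) \<le> length p - 1"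
  unfolding poly_deriv_def using normalize_length_le[of "map (\<lambda>i. [i] \<cdot> coeff p i) (rev [1..<length p])"]
  by simp

text \<open>An element of K[z^p] is f(z) for a polynomial f in X^p, and such f has zero derivative.
  If z itself is f(z), then X - f has root z and derivative 1.\<close>

lemma (in domain) separable_over_of_mem_simple_extension_pow:
  assumes K: "subring K R" and z: "z \<in> carrier R"
    and p: "p = group.ord (add_monoid R) \<one>" and mem: "z \<in> simple_extension K (z [^] p)"
  shows "separable_over K z"
proof -
  interpret UP: domain "K[X]"
    using univ_poly_is_domain[OF K] .
  interpret ev: ring_hom_ring "K[X]" R "\<lambda>p. eval p z"
    using eval_ring_hom[OF K z] .
  note D = poly_deriv_closed[OF K]
  have X: "X \<in> carrier (K[X])"
    using var_closed[OF K] by simp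
  note charpoly = add_pow_characteristic_univ_poly[OF K _ p]
  have DXp: "poly_deriv (X [^]\<^bsub>K[X]\<^esub> p) = \<zero>\<^bsub>K[X]\<^esub>"
  proof (cases p)
    \<comment> \<open>In characteristic 0 the power is X^0 = 1, and the argument goes through
      unchanged.\<close>
    case 0
    then show ?thesis
      using poly_deriv_const[OF K, of \<one>] by (simp add: univ_poly_one univ_poly_zero)
  next
    case (Suc p')
    then show ?thesis
      using poly_deriv_univ_poly_pow[OF K X, of p'] charpoly X D[OF X]
      by (simp del: UP.nat_pow_Suc UP.add.nat_pow_Suc)
  qed
  have "\<exists>f\<in>carrier (K[X]). poly_deriv f = \<zero>\<^bsub>K[X]\<^esub> \<and> eval f z = a"
    if "a \<in> simple_extension K (z [^] p)" for a
    using that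
  proof (induction rule: simple_extension.induct)
    case zero
    show ?case
      by (intro bexI[of _ "[]"]) (auto simp: univ_poly_zero poly_deriv_zero[OF K])
  next
    \<comment> \<open>A \<open>simple_extension\<close> is built by Horner steps: k1 z^p + k2 is the
      value of f X^p + k2.\<close>
    case (lin k1 k2)
    then obtain f where f: "f \<in> carrier (K[X])" "poly_deriv f = \<zero>\<^bsub>K[X]\<^esub>" "eval f z = k1"
      by blast
    let ?c = "poly_of_const k2"
    interpret c: ring_hom_ring "R\<lparr>carrier := K\<rparr>" "K[X]" poly_of_const
      using canonical_embedding_ring_hom[OF K] .
    have c: "?c \<in> carrier (K[X])" "poly_deriv ?c = \<zero>\<^bsub>K[X]\<^esub>" "eval ?c z = k2"
    proof -
      show "?c \<in> carrier (K[X])"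
        using c.hom_closed lin by simp
      show "poly_deriv ?c = \<zero>\<^bsub>K[X]\<^esub>" "eval ?c z = k2"
        using lin(2) z subringE(1)[OF K] unfolding poly_of_const_def
        by (auto simp: poly_deriv_def univ_poly_zero)
    qed
    let ?g = "f \<otimes>\<^bsub>K[X]\<^esub> X [^]\<^bsub>K[X]\<^esub> p \<oplus>\<^bsub>K[X]\<^esub> ?c"
    have "?g \<in> carrier (K[X])" "eval ?g z = k1 \<otimes> z [^] p \<oplus> k2"
      using f c X z by (simp_all add: ev.hom_nat_pow eval_var)
    moreover have "poly_deriv ?g = \<zero>\<^bsub>K[X]\<^esub>"
      using f c X DXp D
      by (simp add: poly_deriv_univ_poly_add[OF K] poly_deriv_univ_poly_mult[OF K])
    ultimately show ?case by blast
  qed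
  then obtain f where f: "f \<in> carrier (K[X])" "poly_deriv f = \<zero>\<^bsub>K[X]\<^esub>" "eval f z = z"
    using mem by blast
  let ?h = "X \<oplus>\<^bsub>K[X]\<^esub> \<ominus>\<^bsub>K[X]\<^esub> f"
  have "?h \<in> carrier (K[X])" "eval ?h z = \<zero>"
    using f X z by (simp_all add: eval_var r_neg)
  moreover have "poly_deriv ?h = \<one>\<^bsub>K[X]\<^esub>"
    using f X by (simp add: poly_deriv_univ_poly_add[OF K] poly_deriv_univ_poly_a_inv[OF K]
        poly_deriv_var[OF K])
  then have "eval (poly_deriv ?h) z \<noteq> \<zero>"
    using ev.hom_one by simp
  ultimately show ?thesis
    unfolding separable_over_def using polynomial_incl by (metis univ_poly_carrier)
qed

text \<open>Descent along derivatives. The leading coefficient of f is multiplied by deg f, which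
  the characteristic does not divide, so f' is nonzero. If x is not a simple root of f, then x is a
  root of f', whose degree is smaller.\<close>

lemma (in domain) separable_over_of_degree_less_characteristic:
  assumes K: "subring K R" and x: "x \<in> carrier R"
    and f: "f \<in> carrier (K[X])" "f \<noteq> []" "eval f x = \<zero>"
    and c: "group.ord (add_monoid R) \<one> = 0 \<or> degree f < group.ord (add_monoid R) \<one>"
  shows "separable_over K x"
  using f c
proof (induction "length f" arbitrary: f rule: less_induct)
  case less
  have sf: "set f \<subseteq> carrier R"
    using poly_in_carrier[OF K less.prems(1)] .
  have lc: "lead_coeff f \<noteq> \<zero>" "lead_coeff f \<in> carrier R"
    using less.prems(1,2) sf lead_coeff_not_zero[of K] by (cases f; auto simp flip: univ_poly_carrier)+
  have deg: "degree f \<noteq> 0"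
  proof
    assume "degree f = 0"
    then have "f = [lead_coeff f]"
      using less.prems(2) by (cases f) auto
    then have "eval f x = lead_coeff f"
      using lc x by (metis eval.simps list.sel(3) length_0_conv list.size(3) nat_pow_0 r_one r_zero
          \<open>degree f = 0\<close> list.discI)
    then show False using lc less.prems by simp
  qed
  then obtain d where d: "degree f = Suc d"
    using not0_implies_Suc by blast
  have sD: "length (poly_deriv f) \<le> Suc d"
    using length_poly_deriv[of f] d by simp
  have "coeff (poly_deriv f) d = [degree f] \<cdot> lead_coeff f"
    using coeff_poly_deriv[OF sf, of d] lead_coeff_simp[OF less.prems(2)] d by simp
  also have "\<dots> = [degree f] \<cdot> \<one> \<otimes> lead_coeff f"
    using lc by (rule_tac add_pow_eq_mult)
  also have "\<dots> \<noteq> \<zero>"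
    using lc less.prems(4) deg add_pow_one_eq_zero_iff[of "degree f"] integral_iff
    by (metis add.nat_pow_closed dvd_imp_le dvd_0_left_iff neq0_conv not_le one_closed)
  finally have D0: "poly_deriv f \<noteq> []"
    by auto
  show ?case
  proof (cases "eval (poly_deriv f) x = \<zero>")
    case True
    have "length (poly_deriv f) < length f"
      using sD d by linarith
    then show ?thesis
      using less.hyps[OF _ poly_deriv_closed[OF K less.prems(1)] D0 True] less.prems(4) by force
  next
    case False
    then show ?thesis
      using less.prems polynomial_incl unfolding separable_over_def by (metis univ_poly_carrier)
  qed
qed

text \<open>A list of length \<open>p * k\<close> splits into blocks of p - 1 zeros followed by one
  coefficient at a multiple of p; each block contributes one coefficient of a polynomial in
  x^p.\<close>

lemma (in cring) eval_map_coeffs_multiples: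
  fixes c :: "nat \<Rightarrow> 'a"
  assumes c: "\<And>i. c i \<in> carrier R" "\<And>i. \<not> p dvd i \<Longrightarrow> c i = \<zero>" and p: "p > 0"
    and x: "x \<in> carrier R"
  shows "eval (map c (rev [0..<p * k])) x = eval (map (\<lambda>i. c (p * i)) (rev [0..<k])) (x [^] p)"
proof (induction k)
  case 0
  then show ?case by simp
next
  case (Suc k)
  have "[0..<p * Suc k] = [0..<p * k] @ p * k # [Suc (p * k)..<p * k + p]"
    using p upt_add_eq_append[of 0 "p * k" p] upt_conv_Cons[of "p * k" "p * k + p"]
    by (simp add: add.commute)
  moreover have "map c [Suc (p * k)..<p * k + p] = replicate (p - 1) \<zero>"
  proof -
    have "c i = \<zero>" if "i \<in> set [Suc (p * k)..<p * k + p]" for i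
    proof (rule c(2))
      have "p * k < i" "i < p * Suc k"
        using that by auto
      then show "\<not> p dvd i"
        by (metis dvdE less_Suc_eq_le mult_less_cancel1 not_less)
    qed
    then have "map c [Suc (p * k)..<p * k + p] = map (\<lambda>i. \<zero>) [Suc (p * k)..<p * k + p]"
      by simp
    then show ?thesis
      by (simp add: map_replicate_const)
  qed
  ultimately have *: "map c (rev [0..<p * Suc k]) =
      replicate (p - 1) \<zero> @ (c (p * k) # map c (rev [0..<p * k]))"
    by (simp flip: rev_map)
  have set: "set (map c l) \<subseteq> carrier R" for l
    using c by auto
  have "eval (map c (rev [0..<p * Suc k])) x = eval (c (p * k) # map c (rev [0..<p * k])) x"
    unfolding * using eval_replicate[of "c (p * k) # map c (rev [0..<p * k])" x "p - 1"] set c x by auto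
  also have "\<dots> = eval (map (\<lambda>i. c (p * i)) (rev [0..<Suc k])) (x [^] p)"
    using Suc x by (simp add: nat_pow_pow)
  finally show ?case .
qed

text \<open>A zero derivative says that i times the i-th coefficient is 0 for all i, so only
  exponents divisible by p occur and f = g(X^p).\<close>

lemma (in domain) zero_poly_deriv_root_pow:
  assumes K: "subring K R" and x: "x \<in> carrier R"
    and p: "p = group.ord (add_monoid R) \<one>" "p \<noteq> 0"
    and f: "f \<in> carrier (K[X])" "f \<noteq> []" "eval f x = \<zero>" "poly_deriv f = []"
  obtains g where "g \<in> carrier (K[X])" "g \<noteq> []" "eval g (x [^] p) = \<zero>" "degree g \<le> degree f div p"
proof -
  have sf: "set f \<subseteq> carrier R"
    using poly_in_carrier[OF K f(1)] .
  have lc: "lead_coeff f \<noteq> \<zero>"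
    using f lead_coeff_not_zero[of K] by (cases f) (auto simp flip: univ_poly_carrier)
  have c0: "coeff f i = \<zero>" if i: "\<not> p dvd i" for i
  proof -
    obtain j where j: "i = Suc j"
      using i by (cases i) auto
    have "[i] \<cdot> \<one> \<otimes> coeff f i = \<zero>"
      using coeff_poly_deriv[OF sf, of j] f(4) j add_pow_eq_mult[of "coeff f i" i] sf by simp
    then show ?thesis
      using add_pow_one_eq_zero_iff[of i] i p integral_iff sf by auto
  qed
  \<comment> \<open>The number of coefficients of g. The product \<open>p * ?k\<close> is at least
    the length of f, so f can be padded with leading zeros to that length.\<close>
  let ?k = "Suc (degree f div p)"
  let ?g = "map (\<lambda>i. coeff f (p * i)) (rev [0..<?k])"
  have len: "length f \<le> p * ?k"
    using dividend_less_times_div[of p "degree f"] p(2) by simp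
  have "map (coeff f) (rev [0..<p * ?k]) = replicate (p * ?k - length f) \<zero> @ f"
  proof -
    have "[0..<p * ?k] = [0..<length f] @ [length f..<p * ?k]"
      using len by (metis le_add_diff_inverse upt_add_eq_append zero_le)
    moreover have "map (coeff f) [length f..<p * ?k] = map (\<lambda>i. \<zero>) [length f..<p * ?k]"
      by (simp add: coeff_length)
    ultimately show ?thesis
      using coeff_list[of f] by (simp add: map_replicate_const flip: rev_map)
  qed
  then have "eval (map (coeff f) (rev [0..<p * ?k])) x = \<zero>"
    using eval_replicate[OF sf x] f(3) by simp
  then have g0: "eval ?g (x [^] p) = \<zero>"
    using eval_map_coeffs_multiples[of "coeff f" p x ?k] c0 sf p(2) x by simp
  have "coeff f i \<in> set f \<union> {\<zero>}" for i
    unfolding coeff_img(3)[of f, symmetric] by simp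
  then have "coeff f i \<in> K" for i
    using f(1) subringE(2)[OF K] polynomial_incl[of K f]
    by (metis Un_iff empty_iff insert_iff subset_iff univ_poly_carrier)
  then have gK: "set ?g \<subseteq> K"
    by auto
  \<comment> \<open>Hence the leading coefficient of f is an entry of \<open>?g\<close>, which
    therefore does not normalize to the empty list.\<close>
  have "p dvd degree f"
    using c0[of "degree f"] lc lead_coeff_simp[OF f(2)] by auto
  then have "lead_coeff f \<in> set ?g"
    using lead_coeff_simp[OF f(2)] by (auto intro!: image_eqI[of _ _ "degree f div p"])
  then have "normalize ?g \<noteq> []"
    using normalize_trick[of ?g] lc by (metis append_Nil2 in_set_replicate)
  moreover have "degree (normalize ?g) \<le> degree f div p"
    using normalize_length_le[of ?g] by (simp del: upt_Suc normalize.simps)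
  moreover have "eval (normalize ?g) (x [^] p) = \<zero>"
    using g0 gK subringE(1)[OF K] x by (subst eval_normalize) auto
  ultimately show thesis
    using that[of "normalize ?g"] normalize_gives_polynomial[OF gK] by (simp add: univ_poly_carrier)
qed

section \<open>The subfield of separable elements\<close>

context field
begin

lemma separable_over_iterated_simple_extension:
  assumes K: "subfield K R" and x: "x \<in> carrier R" "separable_over K x"
    and y: "y \<in> carrier R" "separable_over K y"
    and z: "z \<in> simple_extension (simple_extension K x) y"
  shows "separable_over K z"
proof -
  let ?p = "group.ord (add_monoid R) \<one>"
  have alg: "(algebraic over K) x" "(algebraic over K) y"
    using separable_over_algebraic[OF K] x y by auto
  have fin: "set [y, x] \<subseteq> carrier R" "\<And>u. u \<in> set [y, x] \<Longrightarrow> (algebraic over K) u"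
    using x y alg by auto
  have zF: "z \<in> finite_extension K [y, x]"
    using z by simp
  have zalg: "(algebraic over K) u" if "u \<in> finite_extension K [y, x]" for u
    using finite_extesion_mem_imp_algebraic[OF K fin that] by simp
  note F = finite_extension_is_subring[OF subfieldE(1)[OF K] fin(1)]
  have zc: "z \<in> carrier R"
    using zF subringE(1)[OF F] by blast
  show ?thesis
  proof (cases "?p = 0")
    \<comment> \<open>In characteristic 0 being algebraic is enough.\<close>
    case True
    obtain f where "f \<in> carrier (K[X])" "f \<noteq> []" "eval f z = \<zero>"
      using algebraicE[OF subfieldE(1)[OF K] zc zalg[OF zF]] .
    then show ?thesis
      using separable_over_of_degree_less_characteristic[OF subfieldE(1)[OF K] zc] True by blast
  next
    case False
    \<comment> \<open>Enlarging the base by z^p keeps x and y separable and turns z into a p-th root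
      of an element of the base.\<close>
    let ?E = "simple_extension K (z [^] ?p)"
    let ?E1 = "simple_extension ?E x"
    \<comment> \<open>A priori \<open>?E\<close> is only the ring K[z^p]; it is a field because z^p
      is algebraic.\<close>
    have zp: "z [^] ?p \<in> carrier R" "(algebraic over K) (z [^] ?p)"
    proof -
      interpret F: ring "R\<lparr>carrier := finite_extension K [y, x]\<rparr>"
        using subring_is_ring[OF F] .
      have "z [^] ?p \<in> finite_extension K [y, x]"
        using F.nat_pow_closed[of z ?p] zF by (simp add: nat_pow_consistent[symmetric] del: finite_extension.simps)
      then show "(algebraic over K) (z [^] ?p)"
        by (rule zalg)
    qed (use zc in simp)
    have E: "subfield ?E R"
      using simple_extension_is_subfield[OF K zp(1)] zp(2) by blast
    have KE: "K \<subseteq> ?E"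
      using simple_extension_incl[OF subfieldE(3)[OF K] zp(1)] .
    have E1: "subfield ?E1 R"
      using simple_extension_is_subfield[OF E x(1)] algebraic_mono[OF KE alg(1)] by blast
    have EE1: "?E \<subseteq> ?E1"
      using simple_extension_incl[OF subfieldE(3)[OF E] x(1)] .
    have zpE: "z [^] ?p \<in> ?E"
      using simple_extension_mem[OF subfieldE(1)[OF K] zp(1)] .
    have "z \<in> simple_extension ?E1 y"
      using z mono_simple_extension[OF mono_simple_extension[OF KE, of x], of y] by blast
    \<comment> \<open>The absence of new p-th roots brings z down past y here, and past x in the
      next step.\<close>
    then have "z \<in> ?E1"
      using simple_extension_separable_pth_root[OF E1 y(1) _ _ refl False]
        separable_over_mono[OF y(2)] KE EE1 zpE by blast
    then have "z \<in> ?E"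
      using simple_extension_separable_pth_root[OF E x(1) _ _ refl False]
        separable_over_mono[OF x(2) KE] zpE by blast
    then show ?thesis
      using separable_over_of_mem_simple_extension_pow[OF subfieldE(1)[OF K] zc refl] by blast
  qed
qed

lemma separable_over_base:
  assumes K: "subfield K R" and k: "k \<in> K"
  shows "separable_over K k"
proof -
  have "k \<in> carrier R" "\<one> \<in> K" "\<ominus> k \<in> K"
    using subringE[OF subfieldE(1)[OF K]] k by auto
  then show ?thesis
    unfolding separable_over_def
    by (intro exI[of _ "[\<one>, \<ominus> k]"]) (auto simp: poly_deriv_def r_neg)
qed

text \<open>Sums and products lie in K[x][y], all of whose elements are separable. The inverse of x
  lies in K[x], a field because x is algebraic. Operations on one element use the case y =
  x.\<close>

lemma subfield_of_separables:
  assumes K: "subfield K R"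
  shows "subfield {x \<in> carrier R. separable_over K x} R"
proof -
  have E: "subring (simple_extension (simple_extension K x) y) R" (is ?t1)
    "x \<in> simple_extension (simple_extension K x) y" (is ?t2)
    "y \<in> simple_extension (simple_extension K x) y" (is ?t3)
    if "x \<in> carrier R" "y \<in> carrier R" for x y
  proof -
    have Ex: "subring (simple_extension K x) R"
      using simple_extension_is_subring[OF subfieldE(1)[OF K] that(1)] .
    show ?t1 using simple_extension_is_subring[OF Ex that(2)] .
    show ?t2 using simple_extension_mem[OF subfieldE(1)[OF K] that(1)]
        simple_extension_incl[OF subringE(1)[OF Ex] that(2)] by blast
    show ?t3 using simple_extension_mem[OF Ex that(2)] .
  qed
  show ?thesis
  proof (rule subfieldI'[OF subringI])
    show "\<one> \<in> {x \<in> carrier R. separable_over K x}"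
      using separable_over_base[OF K] subringE(3)[OF subfieldE(1)[OF K]] by simp
  next
    fix x assume "x \<in> {x \<in> carrier R. separable_over K x}"
    then show "\<ominus> x \<in> {x \<in> carrier R. separable_over K x}"
      using separable_over_iterated_simple_extension[OF K, of x x] subringE(5)[OF E(1)] E(2) by auto
  next
    fix x y assume "x \<in> {x \<in> carrier R. separable_over K x}" "y \<in> {x \<in> carrier R. separable_over K x}"
    then show "x \<otimes> y \<in> {x \<in> carrier R. separable_over K x}"
        "x \<oplus> y \<in> {x \<in> carrier R. separable_over K x}"
      using separable_over_iterated_simple_extension[OF K, of x y] subringE(6,7)[OF E(1)] E(2,3) by auto
  next
    fix x assume x: "x \<in> {x \<in> carrier R. separable_over K x} - {\<zero>}"
    have Ex: "subfield (simple_extension K x) R"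
      using simple_extension_is_subfield[OF K] separable_over_algebraic[OF K] x by blast
    then have i: "inv x \<in> simple_extension K x"
      using subfield_m_inv(1)[OF Ex, of x] x simple_extension_mem[OF subfieldE(1)[OF K]] by auto
    then have "inv x \<in> simple_extension (simple_extension K x) x"
      using simple_extension_incl[OF subfieldE(3)[OF Ex]] x by blast
    then show "inv x \<in> {x \<in> carrier R. separable_over K x}"
      using separable_over_iterated_simple_extension[OF K, of x x] i subfieldE(3)[OF Ex] x by auto
  qed auto
qed

lemma separable_over_nat_pow:
  assumes K: "subfield K R" and x: "x \<in> carrier R" "separable_over K x"
  shows "separable_over K (x [^] (n::nat))"
proof (induction n)
  case 0
  then show ?case using subringE(3)[OF subfieldE(1)[OF subfield_of_separables[OF K]]] by simp
next
  case (Suc n)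
  then show ?case
    using subringE(6)[OF subfieldE(1)[OF subfield_of_separables[OF K]], of "x [^] n" x] x by simp
qed

text \<open>If f'(x) = 0 but f' is not the zero polynomial, f' takes the place of f. If f' = 0, then
  x^p is a root of a polynomial of smaller degree, and this loss of degree pays for one factor p of
  the exponent. A surplus in the exponent is harmless, since powers of separable elements are
  separable.\<close>

lemma separable_over_characteristic_pow:
  assumes K: "subfield K R" and x: "x \<in> carrier R"
    and p: "p = group.ord (add_monoid R) \<one>" "p \<noteq> 0"
    and f: "f \<in> carrier (K[X])" "f \<noteq> []" "eval f x = \<zero>" "degree f \<le> n"
  shows "separable_over K (x [^] (p ^ n))"
  using x f
proof (induction "length f" arbitrary: f x n rule: less_induct)
  case less
  note K' = subfieldE(1)[OF K]
  have p2: "p \<ge> 2"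
    using characteristic_cases p prime_ge_2_nat by metis
  show ?case
  proof (cases "eval (poly_deriv f) x = \<zero>")
    case False
    then have "separable_over K x"
      using less.prems polynomial_incl unfolding separable_over_def by (metis univ_poly_carrier)
    then show ?thesis
      using separable_over_nat_pow[OF K] less.prems by blast
  next
    case True
    have len: "length f > 0"
      using less.prems by simp
    show ?thesis
    proof (cases "poly_deriv f = []")
      case False
      have "length (poly_deriv f) < length f"
        using length_poly_deriv[of f] len by linarith
      then show ?thesis
        using less.hyps[OF _ less.prems(1) poly_deriv_closed[OF K' less.prems(2)] False True, of n] less.prems(5)
        by linarith
    next
      case D: True
      obtain g where g: "g \<in> carrier (K[X])" "g \<noteq> []" "eval g (x [^] p) = \<zero>" "degree g \<le> degree f div p"
        using zero_poly_deriv_root_pow[OF K' less.prems(1) p less.prems(2,3,4) D] .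
      have "degree f \<noteq> 0"
      proof
        assume "degree f = 0"
        then obtain k where "f = [k]"
          using less.prems(3) by (cases f) auto
        then show False
          using less.prems subfieldE(3)[OF K] by (auto simp: polynomial_def simp flip: univ_poly_carrier)
      qed
      then have lt: "degree g < degree f"
        using g(4) p2 by (metis One_nat_def div_less_dividend le_less_trans less_le_trans lessI neq0_conv numeral_2_eq_2)
      then obtain m where m: "n = Suc m"
        using less.prems(5) by (cases n) auto
      have "separable_over K ((x [^] p) [^] (p ^ m))"
        using less.hyps[OF _ _ g(1,2,3), of m] lt less.prems m by auto
      then show ?thesis
        using less.prems m by (simp add: nat_pow_pow)
    qed
  qed
qed

end

text \<open>Links the gcd in \<open>separable_poly\<close> with simple roots. By degree, an
  irreducible polynomial divides its derivative only if the derivative is zero; otherwise the two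
  are coprime. For \<open>Irr K x\<close>, dividing the derivative means that the derivative
  vanishes at x.\<close>

lemma (in field) separable_over_iff_Irr:
  assumes K: "subfield K R" and x: "x \<in> carrier R"
  shows "separable_over K x \<longleftrightarrow> (algebraic over K) x \<and> separable_poly R K (Irr K x)"
proof -
  note K' = subfieldE(1)[OF K]
  interpret UP: principal_domain "K[X]"
    using univ_poly_is_principal[OF K] .
  have "separable_over K x \<longleftrightarrow> separable_poly R K (Irr K x)" if alg: "(algebraic over K) x"
  proof -
    note Irr = IrrE[OF K x alg]
    let ?D = "poly_deriv (Irr K x)"
    have D: "?D \<in> carrier (K[X])"
      using poly_deriv_closed[OF K' Irr(1)] .
    have I0: "Irr K x \<noteq> []"
      using pirreducibleE(1)[OF K' Irr(1,2)] .
    have min: "?D = []" if "Irr K x divides\<^bsub>K[X]\<^esub> ?D"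
    proof (rule ccontr)
      assume "?D \<noteq> []"
      then have "degree (Irr K x) \<le> degree ?D"
        using that pdivides_imp_degree_le[OF K' Irr(1) D] pdivides_iff_shell[OF K Irr(1) D] by blast
      moreover have "degree ?D < degree (Irr K x)"
        using length_poly_deriv[of "Irr K x"] pirreducible_degree[OF K Irr(1,2)] \<open>?D \<noteq> []\<close>
        by (cases ?D) auto
      ultimately show False by simp
    qed
    show ?thesis
    proof
      assume sep: "separable_over K x"
      have D0: "?D \<noteq> []"
        using separable_over_Irr[OF K sep x] by auto
      have "y divides\<^bsub>K[X]\<^esub> \<one>\<^bsub>K[X]\<^esub>"
        if y: "y \<in> carrier (K[X])" "y divides\<^bsub>K[X]\<^esub> Irr K x" "y divides\<^bsub>K[X]\<^esub> ?D" for y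
      proof -
        obtain r where r: "r \<in> carrier (K[X])" "Irr K x = y \<otimes>\<^bsub>K[X]\<^esub> r"
          using y(2) unfolding factor_def by blast
        then consider "y \<in> Units (K[X])" | "r \<in> Units (K[X])"
          using pirreducibleE(3)[OF K' Irr(1,2) y(1)] by blast
        then show ?thesis
        proof cases
          case 1
          then show ?thesis
            by (metis UP.Units_r_inv UP.Units_inv_closed factor_def)
        next
          \<comment> \<open>Here y is associated to \<open>Irr K x\<close>, which would then divide
            its own nonzero derivative.\<close>
          case 2
          then have "y = Irr K x \<otimes>\<^bsub>K[X]\<^esub> inv\<^bsub>K[X]\<^esub> r"
            using r y(1) by (simp add: UP.m_assoc)
          then have "Irr K x divides\<^bsub>K[X]\<^esub> y"
            using 2 unfolding factor_def by blast
          then have "Irr K x divides\<^bsub>K[X]\<^esub> ?D"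
            using UP.divides_trans[OF _ y(3) Irr(1)] by blast
          then show ?thesis using min D0 by blast
        qed
      qed
      then show "separable_poly R K (Irr K x)"
        unfolding separable_poly_def isgcd_def using Irr(1) D by (auto simp: factor_def)
    next
      assume "separable_poly R K (Irr K x)"
      then have gcd: "y divides\<^bsub>K[X]\<^esub> \<one>\<^bsub>K[X]\<^esub>"
        if "y \<in> carrier (K[X])" "y divides\<^bsub>K[X]\<^esub> Irr K x" "y divides\<^bsub>K[X]\<^esub> ?D" for y
        using that unfolding separable_poly_def isgcd_def by blast
      have "eval ?D x \<noteq> \<zero>"
      proof
        assume "eval ?D x = \<zero>"
        then have "Irr K x divides\<^bsub>K[X]\<^esub> ?D"
          using Irr_minimal[OF K x alg D] pdivides_iff_shell[OF K Irr(1) D] by blast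
        then have "Irr K x divides\<^bsub>K[X]\<^esub> \<one>\<^bsub>K[X]\<^esub>"
          using gcd Irr(1) by simp
        then have "Irr K x \<in> Units (K[X])"
          using Irr(1) UP.divides_unit by blast
        then show False
          using pirreducibleE(2)[OF K' Irr(1,2)] by blast
      qed
      then show "separable_over K x"
        unfolding separable_over_def using Irr polynomial_incl by (metis univ_poly_carrier)
    qed
  qed
  then show ?thesis
    using separable_over_algebraic[OF K _ x] by blast
qed

lemma (in field) separable_algebraic_iff:
  assumes "subfield K R"
  shows "separable_algebraic K R \<longleftrightarrow> (\<forall>x\<in>carrier R. separable_over K x)"
  unfolding separable_algebraic_def using separable_over_iff_Irr[OF assms] by blast

section \<open>Localization and residue fields\<close>

context primeideal
begin

lemma one_not_in: "\<one> \<notin> I"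
  using I_notcarr one_imp_carrier by blast

lemma complement_mult_closed:
  "s \<in> carrier R - I \<Longrightarrow> t \<in> carrier R - I \<Longrightarrow> s \<otimes> t \<in> carrier R - I"
  using I_prime by auto

lemma complement_one: "\<one> \<in> carrier R - I"
  using one_not_in by simp

lemma equiv_fraction_rel: "equiv (carrier R \<times> (carrier R - I)) (fraction_rel R I)"
proof (rule equivI)
  show "fraction_rel R I \<subseteq> (carrier R \<times> (carrier R - I)) \<times> (carrier R \<times> (carrier R - I))"
    unfolding fraction_rel_def by auto
  show "refl_on (carrier R \<times> (carrier R - I)) (fraction_rel R I)"
    unfolding refl_on_def fraction_rel_def
    by (auto intro!: bexI[of _ \<one>] simp: one_not_in minus_eq r_neg)
  show "sym (fraction_rel R I)"
  proof (rule symI)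
    fix x y assume "(x, y) \<in> fraction_rel R I"
    then obtain a s b t u where *: "x = (a, s)" "y = (b, t)" "a \<in> carrier R" "b \<in> carrier R"
      "s \<in> carrier R - I" "t \<in> carrier R - I" "u \<in> carrier R - I"
      "u \<otimes> (a \<otimes> t \<ominus> b \<otimes> s) = \<zero>"
      unfolding fraction_rel_def by auto
    have "u \<otimes> (b \<otimes> s \<ominus> a \<otimes> t) = \<ominus> (u \<otimes> (a \<otimes> t \<ominus> b \<otimes> s))"
      using *(3-7) by (simp only: Diff_iff) algebra
    also have "\<dots> = \<zero>"
      using * by simp
    finally show "(y, x) \<in> fraction_rel R I"
      unfolding fraction_rel_def using * by auto
  qed
  show "trans (fraction_rel R I)"
  proof (rule transI)
    fix x y z assume "(x, y) \<in> fraction_rel R I" "(y, z) \<in> fraction_rel R I"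
    then obtain a s b t c w u v where *: "x = (a, s)" "y = (b, t)" "z = (c, w)"
      "a \<in> carrier R" "b \<in> carrier R" "c \<in> carrier R"
      "s \<in> carrier R - I" "t \<in> carrier R - I" "w \<in> carrier R - I" "u \<in> carrier R - I" "v \<in> carrier R - I"
      "u \<otimes> (a \<otimes> t \<ominus> b \<otimes> s) = \<zero>" "v \<otimes> (b \<otimes> w \<ominus> c \<otimes> t) = \<zero>"
      unfolding fraction_rel_def by auto
    \<comment> \<open>The extra factor t makes the terms with the middle numerator b cancel in the
      combination of the two given differences.\<close>
    have "(u \<otimes> v \<otimes> t) \<otimes> (a \<otimes> w \<ominus> c \<otimes> s) =
      v \<otimes> w \<otimes> (u \<otimes> (a \<otimes> t \<ominus> b \<otimes> s)) \<oplus> u \<otimes> s \<otimes> (v \<otimes> (b \<otimes> w \<ominus> c \<otimes> t))"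
      using *(4-11) by (simp only: Diff_iff) algebra
    also have "\<dots> = \<zero>"
      unfolding *(12,13) using * by simp
    finally show "(x, z) \<in> fraction_rel R I"
      unfolding fraction_rel_def using * complement_mult_closed by auto
  qed
qed

lemma fraction_eq_iff:
  assumes "a \<in> carrier R" "b \<in> carrier R" "s \<in> carrier R - I" "t \<in> carrier R - I"
  shows "fraction R I a s = fraction R I b t \<longleftrightarrow>
    (\<exists>u\<in>carrier R - I. u \<otimes> (a \<otimes> t \<ominus> b \<otimes> s) = \<zero>)"
  unfolding fraction_def using assms eq_equiv_class_iff[OF equiv_fraction_rel, of "(a, s)" "(b, t)"]
  by (auto simp: fraction_rel_def)

lemma fraction_eqI:
  assumes "a \<in> carrier R" "b \<in> carrier R" "s \<in> carrier R - I" "t \<in> carrier R - I"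
    and "a \<otimes> t = b \<otimes> s"
  shows "fraction R I a s = fraction R I b t"
  using fraction_eq_iff[OF assms(1-4)] assms complement_one
  by (metis DiffD1 m_closed minus_eq r_neg r_null)

lemma mem_fraction:
  assumes "a \<in> carrier R" "s \<in> carrier R - I"
  shows "(b, t) \<in> fraction R I a s \<longleftrightarrow>
    b \<in> carrier R \<and> t \<in> carrier R - I \<and> fraction R I b t = fraction R I a s"
proof -
  have "(b, t) \<in> fraction R I a s \<longleftrightarrow> ((a, s), (b, t)) \<in> fraction_rel R I"
    unfolding fraction_def by blast
  also have "\<dots> \<longleftrightarrow> b \<in> carrier R \<and> t \<in> carrier R - I \<and> fraction R I a s = fraction R I b t"
    using assms fraction_eq_iff[of a b s t] unfolding fraction_rel_def by auto
  finally show ?thesis by auto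
qed

lemma localization_carrier:
  "carrier (localization R I) = {fraction R I a s |a s. a \<in> carrier R \<and> s \<in> carrier R - I}"
  unfolding localization_def fraction_def quotient_def by auto

lemma fraction_closed:
  "a \<in> carrier R \<Longrightarrow> s \<in> carrier R - I \<Longrightarrow> fraction R I a s \<in> carrier (localization R I)"
  unfolding localization_carrier by blast

text \<open>Sums and products in \<open>localization\<close> are unions over all representatives.
  When the value does not depend on the representatives, the union is that value, because fractions
  are nonempty sets of pairs.\<close>

lemma UN_fraction_const:
  assumes "a \<in> carrier R" "s \<in> carrier R - I" "b \<in> carrier R" "t \<in> carrier R - I"
    and "\<And>a' s' b' t'. \<lbrakk>a' \<in> carrier R; s' \<in> carrier R - I; b' \<in> carrier R; t' \<in> carrier R - I;
      fraction R I a' s' = fraction R I a s; fraction R I b' t' = fraction R I b t\<rbrakk> \<Longrightarrow> F a' s' b' t' = c"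
  shows "(\<Union>(a', s')\<in>fraction R I a s. \<Union>(b', t')\<in>fraction R I b t. F a' s' b' t') = c"
proof -
  have "F a' s' b' t' = c" if "(a', s') \<in> fraction R I a s" "(b', t') \<in> fraction R I b t" for a' s' b' t'
    using assms(5)[of a' s' b' t'] that mem_fraction[OF assms(1,2)] mem_fraction[OF assms(3,4)] by simp
  moreover have "(a, s) \<in> fraction R I a s" "(b, t) \<in> fraction R I b t"
    using mem_fraction[OF assms(1,2)] mem_fraction[OF assms(3,4)] assms by simp_all
  ultimately show ?thesis by blast
qed

lemma fraction_mult:
  assumes "a \<in> carrier R" "b \<in> carrier R" "s \<in> carrier R - I" "t \<in> carrier R - I"
  shows "fraction R I a s \<otimes>\<^bsub>localization R I\<^esub> fraction R I b t = fraction R I (a \<otimes> b) (s \<otimes> t)"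
  unfolding localization_def
proof (simp, rule UN_fraction_const[OF assms(1,3,2,4)])
  fix a' s' b' t'
  assume c: "a' \<in> carrier R" "s' \<in> carrier R - I" "b' \<in> carrier R" "t' \<in> carrier R - I"
    and "fraction R I a' s' = fraction R I a s" "fraction R I b' t' = fraction R I b t"
  then obtain u v where uv: "u \<in> carrier R - I" "v \<in> carrier R - I"
    "u \<otimes> (a' \<otimes> s \<ominus> a \<otimes> s') = \<zero>" "v \<otimes> (b' \<otimes> t \<ominus> b \<otimes> t') = \<zero>"
    using fraction_eq_iff assms by metis
  \<comment> \<open>Telescoping: the first factor is exchanged for its other representative, then
    the second.\<close>
  have "(u \<otimes> v) \<otimes> (a' \<otimes> b' \<otimes> (s \<otimes> t) \<ominus> a \<otimes> b \<otimes> (s' \<otimes> t')) =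
      v \<otimes> b' \<otimes> t \<otimes> (u \<otimes> (a' \<otimes> s \<ominus> a \<otimes> s')) \<oplus> u \<otimes> a \<otimes> s' \<otimes> (v \<otimes> (b' \<otimes> t \<ominus> b \<otimes> t'))"
    using assms c uv(1,2) by (simp only: Diff_iff) algebra
  also have "\<dots> = \<zero>"
    unfolding uv(3,4) using assms c uv(1,2) by simp
  finally show "fraction R I (a' \<otimes> b') (s' \<otimes> t') = fraction R I (a \<otimes> b) (s \<otimes> t)"
    using fraction_eq_iff[of "a' \<otimes> b'" "a \<otimes> b" "s' \<otimes> t'" "s \<otimes> t"] assms c uv complement_mult_closed
    by blast
qed

lemma fraction_add:
  assumes "a \<in> carrier R" "b \<in> carrier R" "s \<in> carrier R - I" "t \<in> carrier R - I"
  shows "fraction R I a s \<oplus>\<^bsub>localization R I\<^esub> fraction R I b t =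
    fraction R I (a \<otimes> t \<oplus> b \<otimes> s) (s \<otimes> t)"
  unfolding localization_def
proof (simp, rule UN_fraction_const[OF assms(1,3,2,4)])
  fix a' s' b' t'
  assume c: "a' \<in> carrier R" "s' \<in> carrier R - I" "b' \<in> carrier R" "t' \<in> carrier R - I"
    and "fraction R I a' s' = fraction R I a s" "fraction R I b' t' = fraction R I b t"
  then obtain u v where uv: "u \<in> carrier R - I" "v \<in> carrier R - I"
    "u \<otimes> (a' \<otimes> s \<ominus> a \<otimes> s') = \<zero>" "v \<otimes> (b' \<otimes> t \<ominus> b \<otimes> t') = \<zero>"
    using fraction_eq_iff assms by metis
  have "(u \<otimes> v) \<otimes> ((a' \<otimes> t' \<oplus> b' \<otimes> s') \<otimes> (s \<otimes> t) \<ominus> (a \<otimes> t \<oplus> b \<otimes> s) \<otimes> (s' \<otimes> t')) =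
      v \<otimes> t \<otimes> t' \<otimes> (u \<otimes> (a' \<otimes> s \<ominus> a \<otimes> s')) \<oplus> u \<otimes> s \<otimes> s' \<otimes> (v \<otimes> (b' \<otimes> t \<ominus> b \<otimes> t'))"
    using assms c uv(1,2) by (simp only: Diff_iff) algebra
  also have "\<dots> = \<zero>"
    unfolding uv(3,4) using assms c uv(1,2) by simp
  finally show "fraction R I (a' \<otimes> t' \<oplus> b' \<otimes> s') (s' \<otimes> t') =
      fraction R I (a \<otimes> t \<oplus> b \<otimes> s) (s \<otimes> t)"
    using fraction_eq_iff[of "a' \<otimes> t' \<oplus> b' \<otimes> s'" "a \<otimes> t \<oplus> b \<otimes> s" "s' \<otimes> t'" "s \<otimes> t"]
      assms c uv complement_mult_closed by (meson DiffD1 a_closed m_closed)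
qed

lemma localization_one: "\<one>\<^bsub>localization R I\<^esub> = fraction R I \<one> \<one>"
  and localization_zero: "\<zero>\<^bsub>localization R I\<^esub> = fraction R I \<zero> \<one>"
  unfolding localization_def by simp_all

lemma localization_cases:
  assumes "x \<in> carrier (localization R I)"
  obtains a s where "a \<in> carrier R" "s \<in> carrier R - I" "x = fraction R I a s"
  using assms unfolding localization_carrier by blast

lemma localization_cring: "cring (localization R I)"
proof (rule cringI)
  show "abelian_group (localization R I)"
  proof (rule abelian_groupI)
    fix x y z
    assume "x \<in> carrier (localization R I)" "y \<in> carrier (localization R I)"
      "z \<in> carrier (localization R I)"
    then obtain a s b t c w where *: "x = fraction R I a s" "y = fraction R I b t" "z = fraction R I c w"
      "a \<in> carrier R" "b \<in> carrier R" "c \<in> carrier R"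
      "s \<in> carrier R - I" "t \<in> carrier R - I" "w \<in> carrier R - I"
      by (metis localization_cases)
    then have sc: "s \<in> carrier R" "t \<in> carrier R" "w \<in> carrier R"
      by auto
    have m: "s \<otimes> t \<otimes> w \<in> carrier R - I" "s \<otimes> (t \<otimes> w) \<in> carrier R - I" "s \<otimes> t \<in> carrier R - I"
      "t \<otimes> w \<in> carrier R - I"
      using * complement_mult_closed by blast+
    show "x \<oplus>\<^bsub>localization R I\<^esub> y \<oplus>\<^bsub>localization R I\<^esub> z =
        x \<oplus>\<^bsub>localization R I\<^esub> (y \<oplus>\<^bsub>localization R I\<^esub> z)"
    proof -
      have "((a \<otimes> t \<oplus> b \<otimes> s) \<otimes> w \<oplus> c \<otimes> (s \<otimes> t)) \<otimes> (s \<otimes> (t \<otimes> w)) =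
        (a \<otimes> (t \<otimes> w) \<oplus> (b \<otimes> w \<oplus> c \<otimes> t) \<otimes> s) \<otimes> (s \<otimes> t \<otimes> w)"
        using *(4-6) sc by algebra
      then show ?thesis
        unfolding *(1-3) using *(4-9) sc m by (simp add: fraction_add) (rule fraction_eqI; simp)
    qed
  next
    fix x y
    assume "x \<in> carrier (localization R I)" "y \<in> carrier (localization R I)"
    then obtain a s b t where *: "x = fraction R I a s" "y = fraction R I b t"
      "a \<in> carrier R" "b \<in> carrier R" "s \<in> carrier R - I" "t \<in> carrier R - I"
      by (metis localization_cases)
    then show "x \<oplus>\<^bsub>localization R I\<^esub> y \<in> carrier (localization R I)"
      using complement_mult_closed by (simp add: fraction_add) (rule fraction_closed; simp)
    have "a \<otimes> t \<oplus> b \<otimes> s = b \<otimes> s \<oplus> a \<otimes> t" "s \<otimes> t = t \<otimes> s"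
      using * by (auto simp: a_comm m_comm)
    then show "x \<oplus>\<^bsub>localization R I\<^esub> y = y \<oplus>\<^bsub>localization R I\<^esub> x"
      using * by (simp add: fraction_add)
  next
    show "\<zero>\<^bsub>localization R I\<^esub> \<in> carrier (localization R I)"
      using complement_one by (simp add: localization_zero fraction_closed)
  next
    fix x assume "x \<in> carrier (localization R I)"
    then obtain a s where *: "x = fraction R I a s" "a \<in> carrier R" "s \<in> carrier R - I"
      by (metis localization_cases)
    show "\<zero>\<^bsub>localization R I\<^esub> \<oplus>\<^bsub>localization R I\<^esub> x = x"
      using * complement_one by (simp add: localization_zero fraction_add)
    have "fraction R I (\<ominus> a) s \<oplus>\<^bsub>localization R I\<^esub> x = \<zero>\<^bsub>localization R I\<^esub>"
      using * complement_one complement_mult_closed[of s s]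
      by (simp add: localization_zero fraction_add) (rule fraction_eqI; simp add: l_minus l_neg)
    then show "\<exists>y\<in>carrier (localization R I). y \<oplus>\<^bsub>localization R I\<^esub> x = \<zero>\<^bsub>localization R I\<^esub>"
      using * fraction_closed by (meson a_inv_closed)
  qed
  show "comm_monoid (localization R I)"
  proof (rule comm_monoidI)
    fix x y z
    assume "x \<in> carrier (localization R I)" "y \<in> carrier (localization R I)"
      "z \<in> carrier (localization R I)"
    then obtain a s b t c w where *: "x = fraction R I a s" "y = fraction R I b t" "z = fraction R I c w"
      "a \<in> carrier R" "b \<in> carrier R" "c \<in> carrier R"
      "s \<in> carrier R - I" "t \<in> carrier R - I" "w \<in> carrier R - I"
      by (metis localization_cases)
    then have sc: "s \<in> carrier R" "t \<in> carrier R" "w \<in> carrier R"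
      by auto
    have m: "s \<otimes> t \<in> carrier R - I" "t \<otimes> w \<in> carrier R - I"
      using * complement_mult_closed by blast+
    show "x \<otimes>\<^bsub>localization R I\<^esub> y \<otimes>\<^bsub>localization R I\<^esub> z =
        x \<otimes>\<^bsub>localization R I\<^esub> (y \<otimes>\<^bsub>localization R I\<^esub> z)"
      unfolding *(1-3) using *(4-9) sc m by (simp add: fraction_mult m_assoc)
  next
    fix x y
    assume "x \<in> carrier (localization R I)" "y \<in> carrier (localization R I)"
    then obtain a s b t where *: "x = fraction R I a s" "y = fraction R I b t"
      "a \<in> carrier R" "b \<in> carrier R" "s \<in> carrier R - I" "t \<in> carrier R - I"
      by (metis localization_cases)
    then show "x \<otimes>\<^bsub>localization R I\<^esub> y \<in> carrier (localization R I)"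
      using complement_mult_closed by (simp add: fraction_mult) (rule fraction_closed; simp)
    show "x \<otimes>\<^bsub>localization R I\<^esub> y = y \<otimes>\<^bsub>localization R I\<^esub> x"
      using * by (simp add: fraction_mult m_comm)
  next
    show "\<one>\<^bsub>localization R I\<^esub> \<in> carrier (localization R I)"
      using complement_one by (simp add: localization_one fraction_closed)
  next
    fix x assume "x \<in> carrier (localization R I)"
    then obtain a s where *: "x = fraction R I a s" "a \<in> carrier R" "s \<in> carrier R - I"
      by (metis localization_cases)
    show "\<one>\<^bsub>localization R I\<^esub> \<otimes>\<^bsub>localization R I\<^esub> x = x"
      using * complement_one by (simp add: localization_one fraction_mult)
  qed
  fix x y z
  assume "x \<in> carrier (localization R I)" "y \<in> carrier (localization R I)"
    "z \<in> carrier (localization R I)"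
  then obtain a s b t c w where *: "x = fraction R I a s" "y = fraction R I b t" "z = fraction R I c w"
    "a \<in> carrier R" "b \<in> carrier R" "c \<in> carrier R"
    "s \<in> carrier R - I" "t \<in> carrier R - I" "w \<in> carrier R - I"
    by (metis localization_cases)
  then have sc: "s \<in> carrier R" "t \<in> carrier R" "w \<in> carrier R"
    by auto
  have m: "s \<otimes> t \<otimes> w \<in> carrier R - I" "s \<otimes> w \<otimes> (t \<otimes> w) \<in> carrier R - I" "s \<otimes> t \<in> carrier R - I"
    "t \<otimes> w \<in> carrier R - I" "s \<otimes> w \<in> carrier R - I"
    using * complement_mult_closed by blast+
  \<comment> \<open>The denominators of the two sides of distributivity differ by a factor w, hence
    the comparison by cross-multiplication.\<close>
  have "((a \<otimes> t \<oplus> b \<otimes> s) \<otimes> c) \<otimes> (s \<otimes> w \<otimes> (t \<otimes> w)) =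
      (a \<otimes> c \<otimes> (t \<otimes> w) \<oplus> b \<otimes> c \<otimes> (s \<otimes> w)) \<otimes> (s \<otimes> t \<otimes> w)"
    using *(4-6) sc by algebra
  then show "(x \<oplus>\<^bsub>localization R I\<^esub> y) \<otimes>\<^bsub>localization R I\<^esub> z =
      x \<otimes>\<^bsub>localization R I\<^esub> z \<oplus>\<^bsub>localization R I\<^esub> y \<otimes>\<^bsub>localization R I\<^esub> z"
    unfolding *(1-3) using *(4-9) sc m
    by (simp add: fraction_add fraction_mult) (rule fraction_eqI; simp)
qed

end

section \<open>Residue classes of fractions and the residue field\<close>

definition residue_class :: "('a, 'b) ring_scheme \<Rightarrow> 'a set \<Rightarrow> 'a \<Rightarrow> 'a \<Rightarrow> ('a \<times> 'a) set set"
  where "residue_class R P a s = localized_ideal R P +>\<^bsub>localization R P\<^esub> fraction R P a s"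

text \<open>Serves the union over representatives in \<open>residual_map\<close>.\<close>

lemma UN_pair_const:
  assumes "\<And>b t. (b, t) \<in> U \<Longrightarrow> F b t = c" "p \<in> U"
  shows "(\<Union>(b, t)\<in>U. F b t) = c"
proof -
  have "(case q of (b, t) \<Rightarrow> F b t) = c" if "q \<in> U" for q
    using that assms(1) by (cases q) simp
  then show ?thesis
    using assms(2) by blast
qed

lemma image_Collect_pair: "f ` {g a s |a s. P a s} = {f (g a s) |a s. P a s}"
  by blast

text \<open>Negation is a definite description over the carrier, so it has to be identified anew
  when the carrier shrinks.\<close>

lemma (in ring) a_inv_subring:
  assumes A: "subring A R" and a: "a \<in> A"
  shows "\<ominus>\<^bsub>R\<lparr>carrier := A\<rparr>\<^esub> a = \<ominus> a"
proof -
  interpret A: ring "R\<lparr>carrier := A\<rparr>"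
    by (rule subring_is_ring[OF A])
  have "\<ominus> a \<oplus>\<^bsub>R\<lparr>carrier := A\<rparr>\<^esub> a = \<zero>\<^bsub>R\<lparr>carrier := A\<rparr>\<^esub>"
    using a subringE(1)[OF A] l_neg by auto
  then show ?thesis
    using A.minus_equality[of "\<ominus> a" a] a subringE(5)[OF A a] by simp
qed

context primeideal
begin

interpretation L: cring "localization R I"
  by (rule localization_cring)

lemma fraction_uminus:
  assumes "a \<in> carrier R" "s \<in> carrier R - I"
  shows "\<ominus>\<^bsub>localization R I\<^esub> fraction R I a s = fraction R I (\<ominus> a) s"
proof -
  have "fraction R I (\<ominus> a) s \<oplus>\<^bsub>localization R I\<^esub> fraction R I a s = \<zero>\<^bsub>localization R I\<^esub>"
    using assms complement_one complement_mult_closed[of s s]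
    by (simp add: localization_zero fraction_add) (rule fraction_eqI; simp add: l_minus l_neg)
  then show ?thesis
    using L.minus_equality fraction_closed assms by (meson a_inv_closed)
qed

text \<open>The fractions with numerator in \<open>I\<close> already form an ideal, and each is
  (1/s)(a/1) with a/1 a generator.\<close>

lemma localized_ideal_eq:
  "localized_ideal R I = {fraction R I a s |a s. a \<in> I \<and> s \<in> carrier R - I}" (is "_ = ?J")
  and ideal_localized_ideal: "ideal (localized_ideal R I) (localization R I)"
proof -
  have JI: "fraction R I a s \<in> ?J" if "a \<in> I" "s \<in> carrier R - I" for a s
    using that by blast
  have J: "ideal ?J (localization R I)"
  proof (rule idealI)
    show "ring (localization R I)" ..
    show "subgroup ?J (add_monoid (localization R I))"
    proof (rule L.add.subgroupI)
      show "?J \<subseteq> carrier (localization R I)"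
        using fraction_closed Icarr by blast
      show "?J \<noteq> {}"
        using complement_one additive_subgroup.zero_closed[OF is_additive_subgroup] by blast
    next
      fix x assume "x \<in> ?J"
      then show "\<ominus>\<^bsub>localization R I\<^esub> x \<in> ?J"
        using fraction_uminus Icarr a_inv_closed by blast
    next
      fix x y assume "x \<in> ?J" "y \<in> ?J"
      then obtain a s b t where *: "x = fraction R I a s" "y = fraction R I b t"
        "a \<in> I" "b \<in> I" "s \<in> carrier R - I" "t \<in> carrier R - I"
        by blast
      moreover have "a \<otimes> t \<oplus> b \<otimes> s \<in> I"
        using * I_r_closed by simp
      ultimately show "x \<oplus>\<^bsub>localization R I\<^esub> y \<in> ?J"
        using JI[OF _ complement_mult_closed[OF *(5,6)]] Icarr by (simp add: fraction_add)
    qed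
    fix x y assume "x \<in> ?J" "y \<in> carrier (localization R I)"
    then obtain a s b t where *: "x = fraction R I a s" "y = fraction R I b t"
      "a \<in> I" "b \<in> carrier R" "s \<in> carrier R - I" "t \<in> carrier R - I"
      unfolding localization_carrier by blast
    moreover have "a \<otimes> b \<in> I" "b \<otimes> a \<in> I"
      using * I_r_closed I_l_closed by auto
    ultimately show "y \<otimes>\<^bsub>localization R I\<^esub> x \<in> ?J" "x \<otimes>\<^bsub>localization R I\<^esub> y \<in> ?J"
      using JI[OF _ complement_mult_closed[OF *(5,6)]] JI[OF _ complement_mult_closed[OF *(6,5)]] Icarr
      by (simp_all add: fraction_mult)
  qed
  let ?g = "(\<lambda>a. fraction R I a \<one>) ` I"
  have g: "?g \<subseteq> carrier (localization R I)"
    using fraction_closed Icarr complement_one by blast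
  have "localized_ideal R I \<subseteq> ?J"
    unfolding localized_ideal_def using complement_one by (intro L.genideal_minimal[OF J]) blast
  moreover have "?J \<subseteq> localized_ideal R I"
  proof
    fix x assume "x \<in> ?J"
    then obtain a s where *: "x = fraction R I a s" "a \<in> I" "s \<in> carrier R - I"
      by blast
    then have "x = fraction R I \<one> s \<otimes>\<^bsub>localization R I\<^esub> fraction R I a \<one>"
      using fraction_mult[of \<one> a s \<one>] complement_one Icarr by simp
    moreover have "fraction R I a \<one> \<in> localized_ideal R I"
      using L.genideal_self[OF g] * unfolding localized_ideal_def by blast
    ultimately show "x \<in> localized_ideal R I"
      using ideal.I_l_closed[OF L.genideal_ideal[OF g]] fraction_closed[of \<one> s] *
      unfolding localized_ideal_def by simp
  qed
  ultimately show "localized_ideal R I = ?J" ..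
  then show "ideal (localized_ideal R I) (localization R I)"
    using J by simp
qed

text \<open>Primality makes the choice of representative irrelevant: if u (a t - b s) = 0 with b in
  \<open>I\<close> and u, t outside, then first a t and then a lies in \<open>I\<close>.\<close>

lemma fraction_mem_localized_ideal:
  assumes "a \<in> carrier R" "s \<in> carrier R - I"
  shows "fraction R I a s \<in> localized_ideal R I \<longleftrightarrow> a \<in> I"
proof
  assume "fraction R I a s \<in> localized_ideal R I"
  then obtain b t where b: "b \<in> I" "t \<in> carrier R - I" "fraction R I a s = fraction R I b t"
    unfolding localized_ideal_eq by blast
  then obtain u where u: "u \<in> carrier R - I" "u \<otimes> (a \<otimes> t \<ominus> b \<otimes> s) = \<zero>"
    using fraction_eq_iff[of a b s t] assms Icarr by blast
  have "a \<otimes> t \<ominus> b \<otimes> s \<in> I"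
    using I_prime[of u "a \<otimes> t \<ominus> b \<otimes> s"] u b assms Icarr by auto
  moreover have "b \<otimes> s \<in> I"
    using b assms I_r_closed by simp
  ultimately have "(a \<otimes> t \<ominus> b \<otimes> s) \<oplus> b \<otimes> s \<in> I"
    by simp
  moreover have "(a \<otimes> t \<ominus> b \<otimes> s) \<oplus> b \<otimes> s = a \<otimes> t"
    using assms b Icarr by (simp add: minus_eq a_assoc l_neg)
  ultimately have "a \<otimes> t \<in> I"
    by simp
  then show "a \<in> I"
    using I_prime[of a t] assms b by blast
qed (use assms in \<open>auto simp: localized_ideal_eq\<close>)

interpretation J: ideal "localized_ideal R I" "localization R I"
  by (rule ideal_localized_ideal)

interpretation k: cring "residue_field R I"
  unfolding residue_field_def by (rule J.quotient_is_cring[OF localization_cring])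

lemma residue_field_carrier:
  "carrier (residue_field R I) = {residue_class R I a s |a s. a \<in> carrier R \<and> s \<in> carrier R - I}"
  unfolding residue_field_def FactRing_def A_RCOSETS_def' residue_class_def localization_carrier
  by auto

lemma residue_class_closed:
  "a \<in> carrier R \<Longrightarrow> s \<in> carrier R - I \<Longrightarrow> residue_class R I a s \<in> carrier (residue_field R I)"
  unfolding residue_field_carrier by blast

lemma residue_class_mult:
  assumes "a \<in> carrier R" "b \<in> carrier R" "s \<in> carrier R - I" "t \<in> carrier R - I"
  shows "residue_class R I a s \<otimes>\<^bsub>residue_field R I\<^esub> residue_class R I b t =
    residue_class R I (a \<otimes> b) (s \<otimes> t)"
  using ring_hom_mult[OF J.rcos_ring_hom, of "fraction R I a s" "fraction R I b t"] assms
  unfolding residue_field_def residue_class_def by (simp add: fraction_closed fraction_mult)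

lemma residue_class_add:
  assumes "a \<in> carrier R" "b \<in> carrier R" "s \<in> carrier R - I" "t \<in> carrier R - I"
  shows "residue_class R I a s \<oplus>\<^bsub>residue_field R I\<^esub> residue_class R I b t =
    residue_class R I (a \<otimes> t \<oplus> b \<otimes> s) (s \<otimes> t)"
  using ring_hom_add[OF J.rcos_ring_hom, of "fraction R I a s" "fraction R I b t"] assms
  unfolding residue_field_def residue_class_def by (simp add: fraction_closed fraction_add)

lemma residue_class_one: "\<one>\<^bsub>residue_field R I\<^esub> = residue_class R I \<one> \<one>"
  using ring_hom_one[OF J.rcos_ring_hom]
  unfolding residue_field_def residue_class_def localization_one by simp

lemma residue_class_eq_zero_iff:
  assumes "a \<in> carrier R" "s \<in> carrier R - I"
  shows "residue_class R I a s = \<zero>\<^bsub>residue_field R I\<^esub> \<longleftrightarrow> a \<in> I"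
proof -
  have "residue_class R I a s = \<zero>\<^bsub>residue_field R I\<^esub> \<longleftrightarrow> fraction R I a s \<in> localized_ideal R I"
    unfolding residue_class_def residue_field_def FactRing_def
    using J.rcos_const_imp_mem J.a_rcos_const fraction_closed[OF assms] by auto
  then show ?thesis
    using fraction_mem_localized_ideal[OF assms] by simp
qed

lemma residue_class_uminus:
  assumes "a \<in> carrier R" "s \<in> carrier R - I"
  shows "\<ominus>\<^bsub>residue_field R I\<^esub> residue_class R I a s = residue_class R I (\<ominus> a) s"
proof -
  have "residue_class R I (\<ominus> a) s \<oplus>\<^bsub>residue_field R I\<^esub> residue_class R I a s = \<zero>\<^bsub>residue_field R I\<^esub>"
    using assms complement_mult_closed[of s s]
    by (simp add: residue_class_add residue_class_eq_zero_iff l_minus l_neg)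
  then show ?thesis
    using k.minus_equality residue_class_closed assms by (meson a_inv_closed)
qed

text \<open>The difference of the two residues has numerator a t - b s. The auxiliary factor u from
  equality of fractions is absorbed by primality.\<close>

lemma residue_class_eq_iff:
  assumes "a \<in> carrier R" "b \<in> carrier R" "s \<in> carrier R - I" "t \<in> carrier R - I"
  shows "residue_class R I a s = residue_class R I b t \<longleftrightarrow> a \<otimes> t \<ominus> b \<otimes> s \<in> I"
proof -
  have "residue_class R I a s = residue_class R I b t \<longleftrightarrow>
    residue_class R I a s \<ominus>\<^bsub>residue_field R I\<^esub> residue_class R I b t = \<zero>\<^bsub>residue_field R I\<^esub>"
    using residue_class_closed assms by (simp add: k.r_right_minus_eq)
  also have "residue_class R I a s \<ominus>\<^bsub>residue_field R I\<^esub> residue_class R I b t =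
      residue_class R I (a \<otimes> t \<ominus> b \<otimes> s) (s \<otimes> t)"
    using assms by (simp add: k.minus_eq residue_class_uminus residue_class_add l_minus minus_eq)
  also have "\<dots> = \<zero>\<^bsub>residue_field R I\<^esub> \<longleftrightarrow> a \<otimes> t \<ominus> b \<otimes> s \<in> I"
    using assms complement_mult_closed by (subst residue_class_eq_zero_iff) auto
  finally show ?thesis .
qed

lemma residue_class_inverse:
  assumes "a \<in> carrier R - I" "s \<in> carrier R - I"
  shows "residue_class R I a s \<otimes>\<^bsub>residue_field R I\<^esub> residue_class R I s a = \<one>\<^bsub>residue_field R I\<^esub>"
proof -
  have "a \<otimes> s \<otimes> \<one> \<ominus> \<one> \<otimes> (s \<otimes> a) = \<zero>"
    using assms by (simp add: m_comm minus_eq r_neg)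
  then have "a \<otimes> s \<otimes> \<one> \<ominus> \<one> \<otimes> (s \<otimes> a) \<in> I"
    by simp
  then have "residue_class R I (a \<otimes> s) (s \<otimes> a) = residue_class R I \<one> \<one>"
    using assms complement_mult_closed[of s a] complement_one
      residue_class_eq_iff[of "a \<otimes> s" \<one> "s \<otimes> a" \<one>] by blast
  then show ?thesis
    using assms by (simp add: residue_class_mult residue_class_one)
qed

lemma residue_field_field: "field (residue_field R I)"
proof (rule k.cring_fieldI2)
  show "\<zero>\<^bsub>residue_field R I\<^esub> \<noteq> \<one>\<^bsub>residue_field R I\<^esub>"
    using residue_class_eq_zero_iff[of \<one> \<one>] complement_one by (auto simp: residue_class_one)
next
  fix x assume "x \<in> carrier (residue_field R I)" "x \<noteq> \<zero>\<^bsub>residue_field R I\<^esub>"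
  then obtain a s where "x = residue_class R I a s" "a \<in> carrier R - I" "s \<in> carrier R - I"
    unfolding residue_field_carrier using residue_class_eq_zero_iff by blast
  then show "\<exists>y\<in>carrier (residue_field R I). x \<otimes>\<^bsub>residue_field R I\<^esub> y = \<one>\<^bsub>residue_field R I\<^esub>"
    using residue_class_inverse residue_class_closed by blast
qed

lemma residue_hom: "ring_hom_ring R (residue_field R I) (\<lambda>a. residue_class R I a \<one>)"
proof (rule ring_hom_ringI)
  show "ring R" "ring (residue_field R I)" ..
qed (use complement_one in \<open>auto simp: residue_class_closed residue_class_mult residue_class_add residue_class_one\<close>)

text \<open>Reduces claims about all residues to residues of ring elements, provided that the claim
  passes to quotients.\<close>

lemma residue_class_as_quotient:
  assumes "a \<in> carrier R" "s \<in> carrier R - I"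
  shows "residue_class R I a s = residue_class R I a \<one> \<otimes>\<^bsub>residue_field R I\<^esub>
    inv\<^bsub>residue_field R I\<^esub> residue_class R I s \<one>"
proof -
  have "inv\<^bsub>residue_field R I\<^esub> residue_class R I s \<one> = residue_class R I \<one> s"
    using residue_class_inverse[of s \<one>] assms complement_one residue_class_closed
    by (intro k.comm_inv_char) auto
  then show ?thesis
    using assms complement_one by (simp add: residue_class_mult)
qed

text \<open>A residue class is a set of fractions and a fraction is a set of pairs; the union
  collects the pairs over which \<open>residual_map\<close> ranges.\<close>

lemma mem_Union_residue_class:
  assumes "a \<in> carrier R" "s \<in> carrier R - I"
  shows "(b, t) \<in> \<Union>(residue_class R I a s) \<longleftrightarrow>
    b \<in> carrier R \<and> t \<in> carrier R - I \<and> residue_class R I b t = residue_class R I a s"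
proof
  assume "(b, t) \<in> \<Union>(residue_class R I a s)"
  then obtain F where F: "F \<in> residue_class R I a s" "(b, t) \<in> F"
    by blast
  have eq: "localized_ideal R I +>\<^bsub>localization R I\<^esub> F = residue_class R I a s"
    and "F \<in> carrier (localization R I)"
    using F(1) J.a_repr_independence'[of F "fraction R I a s"] fraction_closed[OF assms]
      J.a_elemrcos_carrier[OF fraction_closed[OF assms]]
    unfolding residue_class_def by auto
  then obtain c u where "c \<in> carrier R" "u \<in> carrier R - I" "F = fraction R I c u"
    using localization_cases by metis
  then have "b \<in> carrier R" "t \<in> carrier R - I" "F = fraction R I b t"
    using F(2) mem_fraction by auto
  then show "b \<in> carrier R \<and> t \<in> carrier R - I \<and> residue_class R I b t = residue_class R I a s"
    using eq unfolding residue_class_def by simp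
next
  assume *: "b \<in> carrier R \<and> t \<in> carrier R - I \<and> residue_class R I b t = residue_class R I a s"
  then have "fraction R I b t \<in> residue_class R I a s"
    using J.a_rcos_self[OF fraction_closed, of b t] unfolding residue_class_def by simp
  moreover have "(b, t) \<in> fraction R I b t"
    using mem_fraction * by simp
  ultimately show "(b, t) \<in> \<Union>(residue_class R I a s)"
    by blast
qed

section \<open>Contraction to a subring and the residual subfield\<close>

lemma primeideal_contract:
  assumes A: "subring A R"
  shows "primeideal (I \<inter> A) (R\<lparr>carrier := A\<rparr>)"
proof -
  note AE = subringE[OF A]
  interpret A: cring "R\<lparr>carrier := A\<rparr>"
    using subcring_iff[OF AE(1)] subcringI'[OF A] by blast
  have "ideal (I \<inter> A) (R\<lparr>carrier := A\<rparr>)"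
  proof (rule idealI)
    show "ring (R\<lparr>carrier := A\<rparr>)" ..
    note inv = a_inv_subring[OF A]
    show "subgroup (I \<inter> A) (add_monoid (R\<lparr>carrier := A\<rparr>))"
    proof (rule A.add.subgroupI)
      have "\<zero> \<in> I \<inter> A"
        using AE by simp
      then show "I \<inter> A \<noteq> {}"
        by blast
    qed (use AE in \<open>auto simp: inv\<close>)
  qed (use AE I_l_closed I_r_closed in auto)
  then show ?thesis
  proof (rule primeidealI)
    show "carrier (R\<lparr>carrier := A\<rparr>) \<noteq> I \<inter> A"
      using AE(3) one_not_in by auto
    fix a b assume "a \<in> carrier (R\<lparr>carrier := A\<rparr>)" "b \<in> carrier (R\<lparr>carrier := A\<rparr>)"
      "a \<otimes>\<^bsub>R\<lparr>carrier := A\<rparr>\<^esub> b \<in> I \<inter> A"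
    then show "a \<in> I \<inter> A \<or> b \<in> I \<inter> A"
      using I_prime[of a b] AE(1) by auto
  qed (rule A.is_cring)
qed

text \<open>Over \<open>A\<close> as over the whole ring, b/t and a/s have equal residues iff b s -
  a t lies in \<open>I\<close>. So all representatives of a residue over \<open>A\<close> have the
  same image.\<close>

lemma residual_subfield_eq:
  assumes A: "subring A R"
  shows "residual_subfield A R I = {residue_class R I a s |a s. a \<in> A \<and> s \<in> A - I}"
proof -
  note AE = subringE[OF A]
  let ?A = "R\<lparr>carrier := A\<rparr>"
  interpret A: primeideal "I \<inter> A" ?A
    by (rule primeideal_contract[OF A])
  note inv = a_inv_subring[OF A]
  have map: "residual_map R I (residue_class ?A (I \<inter> A) a s) = residue_class R I a s"
    if as: "a \<in> A" "s \<in> A - I" for a s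
  proof -
    have "residue_class R I b t = residue_class R I a s"
      if "(b, t) \<in> \<Union>(residue_class ?A (I \<inter> A) a s)" for b t
    proof -
      have b: "b \<in> A" "t \<in> A - I" "residue_class ?A (I \<inter> A) b t = residue_class ?A (I \<inter> A) a s"
        using A.mem_Union_residue_class[of a s b t] as that by auto
      then have "b \<otimes> s \<ominus>\<^bsub>?A\<^esub> a \<otimes> t \<in> I"
        using A.residue_class_eq_iff[of b a t s] as by simp
      then have "b \<otimes> s \<ominus> a \<otimes> t \<in> I"
        using as b AE(6) inv[of "a \<otimes> t"] A.minus_eq[of "b \<otimes> s" "a \<otimes> t"] by (simp add: minus_eq)
      then show ?thesis
        using residue_class_eq_iff[of b a t s] as b AE(1) by blast
    qed
    moreover have "(a, s) \<in> \<Union>(residue_class ?A (I \<inter> A) a s)"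
      using A.mem_Union_residue_class[of a s a s] as by simp
    ultimately have "(\<Union>(b, t)\<in>\<Union>(residue_class ?A (I \<inter> A) a s). residue_class R I b t) =
        residue_class R I a s"
      by (intro UN_pair_const)
    then show ?thesis
      unfolding residual_map_def residue_class_def[of R] .
  qed
  have "carrier (residue_field ?A (I \<inter> A)) =
      {residue_class ?A (I \<inter> A) a s |a s. a \<in> A \<and> s \<in> A - I}"
    unfolding A.residue_field_carrier by auto
  then have "residual_subfield A R I =
      {residual_map R I (residue_class ?A (I \<inter> A) a s) |a s. a \<in> A \<and> s \<in> A - I}"
    unfolding residual_subfield_def by (simp only: image_Collect_pair)
  also have "\<dots> = {residue_class R I a s |a s. a \<in> A \<and> s \<in> A - I}"
    by (simp add: map cong: rev_conj_cong)
  finally show ?thesis .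
qed

lemma subfield_residual_subfield:
  assumes A: "subring A R"
  shows "subfield (residual_subfield A R I) (residue_field R I)"
proof -
  interpret k: field "residue_field R I"
    by (rule residue_field_field)
  note AE = subringE[OF A]
  have A1: "\<one> \<in> A - I"
    using AE one_not_in by simp
  have m: "s \<otimes> t \<in> A - I" if "s \<in> A - I" "t \<in> A - I" for s t
    using that AE complement_mult_closed[of s t] by blast
  show ?thesis
    unfolding residual_subfield_eq[OF A]
  proof (rule k.subfieldI'[OF k.subringI])
    show "{residue_class R I a s |a s. a \<in> A \<and> s \<in> A - I} \<subseteq> carrier (residue_field R I)"
      using residue_class_closed AE(1) by blast
    show "\<one>\<^bsub>residue_field R I\<^esub> \<in> {residue_class R I a s |a s. a \<in> A \<and> s \<in> A - I}"
      using A1 unfolding residue_class_one by blast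
  next
    fix x assume "x \<in> {residue_class R I a s |a s. a \<in> A \<and> s \<in> A - I}"
    then show "\<ominus>\<^bsub>residue_field R I\<^esub> x \<in> {residue_class R I a s |a s. a \<in> A \<and> s \<in> A - I}"
      using residue_class_uminus AE(1,5) by blast
  next
    fix x y assume "x \<in> {residue_class R I a s |a s. a \<in> A \<and> s \<in> A - I}"
      "y \<in> {residue_class R I a s |a s. a \<in> A \<and> s \<in> A - I}"
    then obtain a s b t where *: "x = residue_class R I a s" "y = residue_class R I b t"
      "a \<in> A" "b \<in> A" "s \<in> A - I" "t \<in> A - I"
      by blast
    then have c: "a \<in> carrier R" "b \<in> carrier R" "s \<in> carrier R - I" "t \<in> carrier R - I"
      using AE(1) by auto
    have "a \<otimes> b \<in> A" "a \<otimes> t \<oplus> b \<otimes> s \<in> A"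
      using * AE(6,7) by auto
    then show "x \<otimes>\<^bsub>residue_field R I\<^esub> y \<in> {residue_class R I a s |a s. a \<in> A \<and> s \<in> A - I}"
      "x \<oplus>\<^bsub>residue_field R I\<^esub> y \<in> {residue_class R I a s |a s. a \<in> A \<and> s \<in> A - I}"
      using residue_class_mult[OF c] residue_class_add[OF c] m *(1,2,5,6) by blast+
  next
    fix x assume "x \<in> {residue_class R I a s |a s. a \<in> A \<and> s \<in> A - I} - {\<zero>\<^bsub>residue_field R I\<^esub>}"
    then obtain a s where *: "x = residue_class R I a s" "a \<in> A" "s \<in> A - I" "x \<noteq> \<zero>\<^bsub>residue_field R I\<^esub>"
      by blast
    then have a: "a \<in> A - I" "a \<in> carrier R - I" "s \<in> carrier R - I"
      using residue_class_eq_zero_iff[of a s] AE(1) by auto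
    then have "inv\<^bsub>residue_field R I\<^esub> x = residue_class R I s a"
      using residue_class_inverse[OF a(2,3)] residue_class_closed *(1) by (intro k.comm_inv_char) auto
    then show "inv\<^bsub>residue_field R I\<^esub> x \<in> {residue_class R I a s |a s. a \<in> A \<and> s \<in> A - I}"
      using a * by blast
  qed
qed

end

section \<open>Lying over\<close>

text \<open>\<open>P\<close> is maximal among the ideals disjoint from \<open>M\<close>. The last
  conclusion expresses this maximality by elements; it yields primality here and is exported for the
  proof of lying over.\<close>

lemma (in cring) exists_primeideal_disjoint:
  assumes M: "M \<subseteq> carrier R" "\<one> \<in> M" "\<zero> \<notin> M"
    and mult: "\<And>a b. a \<in> M \<Longrightarrow> b \<in> M \<Longrightarrow> a \<otimes> b \<in> M"
  obtains P where "primeideal P R" "P \<inter> M = {}"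
    "\<And>a. a \<in> carrier R - P \<Longrightarrow> \<exists>q\<in>P. \<exists>r\<in>carrier R. q \<oplus> r \<otimes> a \<in> M"
proof -
  let ?F = "{J. ideal J R \<and> J \<inter> M = {}}"
  have "\<exists>P\<in>?F. \<forall>J\<in>?F. P \<subseteq> J \<longrightarrow> J = P"
  proof (rule subset_Zorn_nonempty)
    show "?F \<noteq> {}"
      using zeroideal M(3) by auto
    fix C assume C: "C \<noteq> {}" "subset.chain ?F C"
    then have "subset.chain {J. ideal J R} C"
      unfolding subset_chain_def by blast
    then have "ideal (\<Union>C) R"
      using chain_Union_is_ideal[of C] C(1) by simp
    then show "\<Union>C \<in> ?F"
      using C unfolding subset_chain_def by blast
  qed
  then obtain P where PF: "P \<in> ?F" and max': "\<forall>J\<in>?F. P \<subseteq> J \<longrightarrow> J = P"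
    by (rule bexE)
  then have P: "ideal P R" "P \<inter> M = {}"
    by simp_all
  have max: "J = P" if "ideal J R" "J \<inter> M = {}" "P \<subseteq> J" for J
    using max' that by simp
  interpret P: ideal P R by (rule P(1))
  have ex: "\<exists>q\<in>P. \<exists>r\<in>carrier R. q \<oplus> r \<otimes> a \<in> M" if a: "a \<in> carrier R - P" for a
  proof -
    let ?J = "P <+>\<^bsub>R\<^esub> PIdl a"
    have J: "ideal ?J R"
      using add_ideals[OF P(1) cgenideal_ideal] a by simp
    have z: "\<zero> \<in> PIdl a"
      using additive_subgroup.zero_closed[OF ideal.axioms(1)[OF cgenideal_ideal]] a by simp
    have "P \<subseteq> ?J"
    proof
      fix q assume "q \<in> P"
      then have "q = q \<oplus> \<zero>" using P.Icarr by simp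
      then show "q \<in> ?J"
        using \<open>q \<in> P\<close> z unfolding set_add_def' by blast
    qed
    moreover have "a \<in> ?J"
    proof -
      have "a = \<zero> \<oplus> a" using a by simp
      then show ?thesis
        using cgenideal_self[of a] a P.zero_closed unfolding set_add_def' by blast
    qed
    ultimately have "?J \<inter> M \<noteq> {}"
      using max[OF J] a by blast
    then show ?thesis
      unfolding set_add_def' cgenideal_def by blast
  qed
  have "primeideal P R"
  proof (rule primeidealI[OF P(1) is_cring])
    show "carrier R \<noteq> P"
      using M P(2) by blast
    fix a b assume ab: "a \<in> carrier R" "b \<in> carrier R" "a \<otimes> b \<in> P"
    show "a \<in> P \<or> b \<in> P"
    proof (rule ccontr)
      assume "\<not> (a \<in> P \<or> b \<in> P)"
      then have "a \<in> carrier R - P" "b \<in> carrier R - P"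
        using ab by simp_all
      from ex[OF this(1)] ex[OF this(2)]
      obtain q r q' r' where *: "q \<in> P" "r \<in> carrier R" "q \<oplus> r \<otimes> a \<in> M"
        "q' \<in> P" "r' \<in> carrier R" "q' \<oplus> r' \<otimes> b \<in> M"
        by (elim bexE)
      note c = *(2,5) P.Icarr[OF *(1)] P.Icarr[OF *(4)] ab(1,2)
      \<comment> \<open>Every term on the right has a factor in \<open>P\<close>, whereas the left
        side is a product of elements of \<open>M\<close>.\<close>
      have "(q \<oplus> r \<otimes> a) \<otimes> (q' \<oplus> r' \<otimes> b) =
          q \<otimes> (q' \<oplus> r' \<otimes> b) \<oplus> ((r \<otimes> a) \<otimes> q' \<oplus> (r \<otimes> r') \<otimes> (a \<otimes> b))"
        using c by algebra
      also have "\<dots> \<in> P"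
      proof (intro additive_subgroup.a_closed[OF P.is_additive_subgroup])
        show "q \<otimes> (q' \<oplus> r' \<otimes> b) \<in> P" "(r \<otimes> a) \<otimes> q' \<in> P" "(r \<otimes> r') \<otimes> (a \<otimes> b) \<in> P"
          using c P.I_r_closed[OF *(1)] P.I_l_closed[OF *(4)] P.I_l_closed[OF ab(3)] by simp_all
      qed
      finally show False
        using mult[OF *(3,6)] P(2) by blast
    qed
  qed
  then show thesis
    by (rule that[OF _ P(2) ex])
qed

text \<open>Take \<open>Q\<close> maximal among the ideals disjoint from \<open>T - Q'\<close>. If some \<open>a \<in> Q'\<close> is not in \<open>Q\<close>, then
  \<open>s = q + y a\<close> with \<open>s \<in> T - Q'\<close> and \<open>q \<in> Q\<close>; homogenizing an integral equation of \<open>y\<close> with respect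
  to \<open>a\<close> gives an element of \<open>Q \<inter> T \<subseteq> Q'\<close> that is congruent to a power of \<open>s\<close> modulo \<open>Q'\<close>.\<close>

lemma (in cring) lying_over:
  assumes T: "subring T R" and int: "integral_extension T R"
    and Q': "primeideal Q' (R\<lparr>carrier := T\<rparr>)"
  obtains Q where "primeideal Q R" "Q \<inter> T = Q'"
proof -
  interpret Q': primeideal Q' "R\<lparr>carrier := T\<rparr>" by (rule Q')
  note TE = subringE[OF T]
  have Q'T: "Q' \<subseteq> T"
    using Q'.Icarr by auto
  have Q'add: "u \<oplus> v \<in> Q'" if "u \<in> Q'" "v \<in> Q'" for u v
    using additive_subgroup.a_closed[OF Q'.is_additive_subgroup] that by simp
  have Q'mult: "u \<otimes> v \<in> Q'" if "u \<in> T" "v \<in> Q'" for u v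
    using Q'.I_l_closed[of v u] that by simp
  have Q'0: "\<zero> \<in> Q'"
    using additive_subgroup.zero_closed[OF Q'.is_additive_subgroup] by simp
  have Q'inv: "\<ominus> u \<in> Q'" if u: "u \<in> Q'" for u
  proof -
    have "u \<in> T"
      using u Q'T by blast
    then show ?thesis
      using additive_subgroup.a_inv_closed[OF Q'.is_additive_subgroup u]
      unfolding a_inv_subring[OF T \<open>u \<in> T\<close>] by blast
  qed
  have Tpow: "u [^] (n::nat) \<in> T" if "u \<in> T" for u n
    using that TE(3,6) by (induction n) auto
  have pow: "u [^] (n::nat) \<in> T - Q'" if "u \<in> T - Q'" for u n
  proof (induction n)
    case 0
    then show ?case using TE(3) Q'.one_not_in by simp
  next
    case (Suc n)
    then show ?case using Q'.complement_mult_closed[of "u [^] n" u] that by simp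
  qed
  obtain Q where Q: "primeideal Q R" "Q \<inter> (T - Q') = {}"
    and ex: "\<And>a. a \<in> carrier R - Q \<Longrightarrow> \<exists>q\<in>Q. \<exists>r\<in>carrier R. q \<oplus> r \<otimes> a \<in> T - Q'"
  proof (rule exists_primeideal_disjoint[of "T - Q'"])
    show "\<zero> \<notin> T - Q'"
      using Q'0 by simp
  qed (use TE Q'.one_not_in Q'.complement_mult_closed in auto)
  interpret Q: primeideal Q R by (rule Q(1))
  have "a \<in> Q" if a: "a \<in> Q'" for a
  proof (rule ccontr)
    assume "a \<notin> Q"
    have aT: "a \<in> T" "a \<in> carrier R"
      using a Q'T TE(1) by auto
    then obtain q y where q: "q \<in> Q" "y \<in> carrier R" "q \<oplus> y \<otimes> a \<in> T - Q'"
      using ex \<open>a \<notin> Q\<close> by blast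
    define s where "s = q \<oplus> y \<otimes> a"
    have s: "s \<in> T - Q'" "s \<in> carrier R"
      using q TE(1) by (auto simp: s_def)
    \<comment> \<open>The induction follows Horner's scheme along the monic polynomial: h equals s^n
      modulo \<open>Q'\<close>, and modulo \<open>Q\<close> it equals a^n times the partial Horner
      value at y, where n is the length of \<open>l\<close>.\<close>
    have homog: "\<exists>h\<in>T. \<exists>b\<in>Q'. \<exists>c\<in>Q. h = s [^] length l \<oplus> b \<and>
        h = a [^] length l \<otimes> eval (\<one> # l) y \<oplus> c" if "set l \<subseteq> T" for l
      using that
    proof (induction l rule: rev_induct)
      case Nil
      show ?case
        using TE(3) Q'0 q by (intro bexI[of _ \<one>] bexI[of _ \<zero>]) auto
    next
      case (snoc c l)
      then have l: "set l \<subseteq> T" "c \<in> T"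
        by simp_all
      define e where "e = eval (\<one> # l) y"
      let ?n = "length l"
      from snoc.IH[OF l(1)] obtain h b d where h: "h \<in> T" "b \<in> Q'" "d \<in> Q"
        "h = s [^] ?n \<oplus> b" "h = a [^] ?n \<otimes> e \<oplus> d"
        unfolding e_def by blast
      have lc: "set (\<one> # l) \<subseteq> carrier R"
        using l TE(1) by auto
      have ev: "eval (\<one> # l @ [c]) y = e \<otimes> y \<oplus> c"
        using eval_append_aux[OF lc _ q(2), of c] l TE(1) unfolding e_def by (simp del: eval.simps) blast
      have carr: "h \<in> carrier R" "b \<in> carrier R" "d \<in> carrier R" "c \<in> carrier R" "e \<in> carrier R"
        "a [^] ?n \<in> carrier R" "s [^] ?n \<in> carrier R" "q \<in> carrier R" "a [^] ?n \<in> T"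
        using eval_in_carrier[OF lc q(2)] subsetD[OF TE(1) h(1)] subsetD[OF TE(1) subsetD[OF Q'T h(2)]]
          Q.Icarr[OF h(3)] Q.Icarr[OF q(1)] subsetD[OF TE(1) l(2)] aT(2) s(2) Tpow[OF aT(1)]
        by (simp_all add: e_def del: eval.simps)
      \<comment> \<open>Since s = q + y a, multiplication by s turns a^n e into a^(n+1) e y modulo
        \<open>Q\<close>. The added term supplies the next coefficient and vanishes modulo
        \<open>Q'\<close>, as a lies in \<open>Q'\<close>.\<close>
      let ?h = "h \<otimes> s \<oplus> c \<otimes> (a [^] ?n \<otimes> a)"
      have "?h \<in> T"
        using h(1) s(1) l(2) aT(1) carr(9) TE(6,7) by simp
      moreover have "?h = s [^] Suc ?n \<oplus> (s \<otimes> b \<oplus> c \<otimes> a [^] ?n \<otimes> a)"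
        unfolding h(4) nat_pow_Suc using carr aT s by algebra
      moreover have "s \<otimes> b \<oplus> c \<otimes> a [^] ?n \<otimes> a \<in> Q'"
        using s(1) h(2) a l(2) carr(9) TE(6) by (intro Q'add Q'mult) auto
      moreover have "?h = a [^] Suc ?n \<otimes> eval (\<one> # l @ [c]) y \<oplus> (s \<otimes> d \<oplus> (a [^] ?n \<otimes> e) \<otimes> q)"
        unfolding h(5) ev nat_pow_Suc s_def using carr aT q by algebra
      moreover have "s \<otimes> d \<oplus> (a [^] ?n \<otimes> e) \<otimes> q \<in> Q"
        using h(3) carr s(2) q(1) by (intro additive_subgroup.a_closed[OF Q.is_additive_subgroup] Q.I_l_closed) auto
      ultimately show ?case
        unfolding length_append_singleton by blast
    qed
    obtain p where p: "set p \<subseteq> T" "p \<noteq> []" "lead_coeff p = \<one>" "eval p y = \<zero>"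
      using int q(2) unfolding integral_extension_def by blast
    then obtain l where l: "p = \<one> # l" "set l \<subseteq> T"
      by (cases p) auto
    then obtain h b c where h: "h \<in> T" "b \<in> Q'" "c \<in> Q" "h = s [^] length l \<oplus> b"
      "h = a [^] length l \<otimes> eval (\<one> # l) y \<oplus> c"
      using homog by blast
    \<comment> \<open>For the whole polynomial the Horner value is 0.\<close>
    have "h \<in> Q"
      using h p(4) aT Q.Icarr unfolding l(1) by simp
    then have "h \<in> Q'"
      using Q(2) h(1) by blast
    then have "h \<oplus> \<ominus> b \<in> Q'"
      using Q'add Q'inv h(2) by blast
    moreover have "h \<oplus> \<ominus> b = s [^] length l"
      using s(2) subsetD[OF TE(1) subsetD[OF Q'T h(2)]] by (simp add: h(4) a_assoc r_neg)
    ultimately show False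
      using pow[OF s(1), of "length l"] by simp
  qed
  then have "Q \<inter> T = Q'"
    using Q(2) Q'T by blast
  then show thesis
    using that Q(1) by blast
qed

section \<open>Separability at a prime\<close>

lemma (in ring_hom_ring) hom_add_pow_nat:
  "x \<in> carrier R \<Longrightarrow> h ([(n::nat)] \<cdot>\<^bsub>R\<^esub> x) = [n] \<cdot>\<^bsub>S\<^esub> h x"
  by (induction n) auto

text \<open>Normalizing does not commute with \<open>h\<close>, which may kill leading coefficients.
  The derivatives are therefore compared as unnormalized lists, and evaluation ignores leading
  zeros.\<close>

lemma (in ring_hom_ring) eval_poly_deriv_hom:
  assumes x: "x \<in> carrier R" and p: "set p \<subseteq> carrier R"
  shows "h (R.eval (R.poly_deriv p) x) = eval (poly_deriv (map h p)) (h x)"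
proof -
  let ?q = "map (\<lambda>i. [i] \<cdot>\<^bsub>R\<^esub> R.coeff p i) (rev [1..<length p])"
  let ?q' = "map (\<lambda>i. [i] \<cdot>\<^bsub>S\<^esub> coeff (map h p) i) (rev [1..<length p])"
  have q: "set ?q \<subseteq> carrier R"
    using p by auto
  have hp: "set (map h p) \<subseteq> carrier S"
    using p by auto
  have q': "set ?q' \<subseteq> carrier S"
    using coeff_in_carrier[OF hp] by auto
  have "h (R.eval (R.poly_deriv p) x) = h (R.eval ?q x)"
    unfolding R.poly_deriv_def using R.eval_normalize[OF q x] by simp
  also have "\<dots> = eval (map h ?q) (h x)"
    using eval_hom'[OF x q] .
  also have "map h ?q = ?q'"
    using p by (simp add: hom_add_pow_nat coeff_hom')
  also have "eval ?q' (h x) = eval (poly_deriv (map h p)) (h x)"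
    unfolding poly_deriv_def using eval_normalize[OF q' hom_closed[OF x]] by simp
  finally show ?thesis .
qed

lemma (in cring) eval_scalar:
  assumes "c \<in> carrier R" "set p \<subseteq> carrier R" "x \<in> carrier R"
  shows "eval (map (\<lambda>a. c \<otimes> a) p) x = c \<otimes> eval p x"
  using assms(2)
proof (induction p)
  case Nil
  then show ?case using assms by simp
next
  case (Cons a p)
  then show ?case
    using assms eval_in_carrier[of p x] by (simp add: r_distr m_assoc)
qed

text \<open>Again on unnormalized lists, since multiplication by \<open>c\<close> may kill leading
  coefficients.\<close>

lemma (in cring) eval_poly_deriv_scalar:
  assumes c: "c \<in> carrier R" and p: "set p \<subseteq> carrier R" and x: "x \<in> carrier R"
  shows "eval (poly_deriv (map (\<lambda>a. c \<otimes> a) p)) x = c \<otimes> eval (poly_deriv p) x"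
proof -
  let ?q = "map (\<lambda>i. [i] \<cdot> coeff p i) (rev [1..<length p])"
  let ?q' = "map (\<lambda>i. [i] \<cdot> coeff (map (\<lambda>a. c \<otimes> a) p) i) (rev [1..<length p])"
  have q: "set ?q \<subseteq> carrier R"
    using p by auto
  have eq: "?q' = map (\<lambda>a. c \<otimes> a) ?q"
    using p c by (simp add: scalar_coeff add_pow_rdistr)
  have q': "set ?q' \<subseteq> carrier R"
    using q c unfolding eq by auto
  have "eval (poly_deriv (map (\<lambda>a. c \<otimes> a) p)) x = eval ?q' x"
    unfolding poly_deriv_def using eval_normalize[OF q' x] by simp
  also have "\<dots> = c \<otimes> eval ?q x"
    unfolding eq by (rule eval_scalar[OF c q x])
  also have "eval ?q x = eval (poly_deriv p) x"
    unfolding poly_deriv_def using eval_normalize[OF q x] by simp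
  finally show ?thesis .
qed

definition (in ring) separable_at :: "'a set \<Rightarrow> 'a set \<Rightarrow> 'a \<Rightarrow> bool"
  where "separable_at A P x \<longleftrightarrow>
    (\<exists>p. set p \<subseteq> A \<and> eval p x \<in> P \<and> eval (poly_deriv p) x \<notin> P)"

text \<open>The inclusion of \<open>W\<close> is a homomorphism, so values of polynomials and of
  their derivatives at x are the same in both rings, and they lie in \<open>W\<close>.\<close>

lemma (in ring) separable_at_subring:
  assumes W: "subring W R" "A \<subseteq> W" and x: "x \<in> W"
  shows "ring.separable_at (R\<lparr>carrier := W\<rparr>) A (P \<inter> W) x \<longleftrightarrow> separable_at A P x"
proof -
  interpret W: ring "R\<lparr>carrier := W\<rparr>"
    by (rule subring_is_ring[OF W(1)])
  have "id \<in> ring_hom (R\<lparr>carrier := W\<rparr>) R"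
    using subringE(1)[OF W(1)] by (intro ring_hom_memI) auto
  then interpret i: ring_hom_ring "R\<lparr>carrier := W\<rparr>" R id
    by (intro ring_hom_ringI2 W.ring_axioms ring_axioms)
  have ev: "W.eval p x = eval p x \<and> W.eval (W.poly_deriv p) x = eval (poly_deriv p) x \<and>
      W.eval p x \<in> W \<and> W.eval (W.poly_deriv p) x \<in> W" if "set p \<subseteq> A" for p
  proof -
    have p: "set p \<subseteq> carrier (R\<lparr>carrier := W\<rparr>)" "x \<in> carrier (R\<lparr>carrier := W\<rparr>)"
      using that W(2) x by auto
    have "set (W.poly_deriv p) \<subseteq> carrier (R\<lparr>carrier := W\<rparr>)"
      using W.poly_deriv_polynomial[OF W.carrier_is_subring p(1)] W.polynomial_incl by blast
    then have "W.eval p x \<in> W" "W.eval (W.poly_deriv p) x \<in> W"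
      using W.eval_in_carrier p by fastforce+
    then show ?thesis
      using i.eval_hom'[OF p(2,1)] i.eval_poly_deriv_hom[OF p(2,1)] by simp
  qed
  then show ?thesis
    unfolding W.separable_at_def separable_at_def by (intro iff_exI conj_cong refl) (use ev in auto)
qed

context primeideal
begin

interpretation k: field "residue_field R I"
  by (rule residue_field_field)

interpretation \<phi>: ring_hom_ring R "residue_field R I" "\<lambda>a. residue_class R I a \<one>"
  by (rule residue_hom)

lemma residue_mem_residual_subfield:
  assumes "subring A R" "a \<in> A"
  shows "residue_class R I a \<one> \<in> residual_subfield A R I"
  unfolding residual_subfield_eq[OF assms(1)] using assms subringE(3)[OF assms(1)] one_not_in by blast

lemma residue_eq_zero_iff:
  "a \<in> carrier R \<Longrightarrow> residue_class R I a \<one> = \<zero>\<^bsub>residue_field R I\<^esub> \<longleftrightarrow> a \<in> I"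
  using residue_class_eq_zero_iff[OF _ complement_one] .

text \<open>By induction on the list: if s clears the tail, then s t clears a further entry a/t,
  giving s a, while the tail cleared before is multiplied by t. An equation between lists, entry by
  entry, avoids normalization.\<close>

lemma clear_denominators:
  assumes A: "subring A R" and f: "set f \<subseteq> residual_subfield A R I"
  obtains s p where "s \<in> A - I" "set p \<subseteq> A"
    "map (\<lambda>a. residue_class R I a \<one>) p = map (\<lambda>c. residue_class R I s \<one> \<otimes>\<^bsub>residue_field R I\<^esub> c) f"
proof -
  note AE = subringE[OF A]
  have "\<exists>s\<in>A - I. \<exists>p. set p \<subseteq> A \<and>
    map (\<lambda>a. residue_class R I a \<one>) p = map (\<lambda>c. residue_class R I s \<one> \<otimes>\<^bsub>residue_field R I\<^esub> c) f"
    using f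
  proof (induction f)
    case Nil
    then show ?case
      using AE(3) one_not_in by (intro bexI[of _ \<one>] exI[of _ "[]"]) auto
  next
    case (Cons c f)
    then obtain s p where s: "s \<in> A - I" "set p \<subseteq> A"
      "map (\<lambda>a. residue_class R I a \<one>) p = map (\<lambda>c. residue_class R I s \<one> \<otimes>\<^bsub>residue_field R I\<^esub> c) f"
      by auto
    obtain a t where a: "a \<in> A" "t \<in> A - I" "c = residue_class R I a t"
      using Cons.prems unfolding residual_subfield_eq[OF A] by auto
    have carr: "a \<in> carrier R" "s \<in> carrier R - I" "t \<in> carrier R - I" "\<And>b. b \<in> set p \<Longrightarrow> b \<in> carrier R"
      using a s AE(1) by auto
    have fc: "d \<in> carrier (residue_field R I)" if "d \<in> set f" for d
      using Cons.prems that k.subring_props(1) subfieldE(3)[OF subfield_residual_subfield[OF A]] by auto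
    have st: "s \<otimes> t \<in> A - I"
      using a s AE(6) complement_mult_closed[of s t] carr by auto
    have \<phi>st: "residue_class R I (s \<otimes> t) \<one> =
        residue_class R I t \<one> \<otimes>\<^bsub>residue_field R I\<^esub> residue_class R I s \<one>"
      using carr \<phi>.hom_mult[of t s] by (simp add: m_comm)
    have "residue_class R I (s \<otimes> t) \<one> \<otimes>\<^bsub>residue_field R I\<^esub> c = residue_class R I (s \<otimes> a) \<one>"
    proof -
      have "s \<otimes> t \<otimes> a \<otimes> \<one> \<ominus> s \<otimes> a \<otimes> (\<one> \<otimes> t) = \<zero>"
        using carr by (simp add: m_ac minus_eq r_neg)
      then have "s \<otimes> t \<otimes> a \<otimes> \<one> \<ominus> s \<otimes> a \<otimes> (\<one> \<otimes> t) \<in> I"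
        by simp
      then have "residue_class R I (s \<otimes> t \<otimes> a) (\<one> \<otimes> t) = residue_class R I (s \<otimes> a) \<one>"
        using carr complement_one residue_class_eq_iff[of "s \<otimes> t \<otimes> a" "s \<otimes> a" "\<one> \<otimes> t" \<one>]
          complement_mult_closed[of \<one> t] by blast
      moreover have "residue_class R I (s \<otimes> t) \<one> \<otimes>\<^bsub>residue_field R I\<^esub> c =
          residue_class R I (s \<otimes> t \<otimes> a) (\<one> \<otimes> t)"
        unfolding a(3) using carr complement_one by (intro residue_class_mult) auto
      ultimately show ?thesis
        by (rule trans[rotated])
    qed
    moreover have "map (\<lambda>a. residue_class R I a \<one>) (map (\<lambda>a. t \<otimes> a) p) =
        map (\<lambda>c. residue_class R I (s \<otimes> t) \<one> \<otimes>\<^bsub>residue_field R I\<^esub> c) f"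
    proof -
      have "map (\<lambda>a. residue_class R I a \<one>) (map (\<lambda>a. t \<otimes> a) p) =
          map (\<lambda>a. residue_class R I t \<one> \<otimes>\<^bsub>residue_field R I\<^esub> a) (map (\<lambda>a. residue_class R I a \<one>) p)"
        using carr by simp
      also have "\<dots> = map (\<lambda>c. residue_class R I (s \<otimes> t) \<one> \<otimes>\<^bsub>residue_field R I\<^esub> c) f"
        unfolding s(3) \<phi>st using carr fc by (simp add: k.m_assoc)
      finally show ?thesis .
    qed
    moreover have "set (s \<otimes> a # map (\<lambda>a. t \<otimes> a) p) \<subseteq> A"
      using s a AE(6) by auto
    ultimately show ?case
      using st by (intro bexI[OF _ st] exI[of _ "s \<otimes> a # map (\<lambda>a. t \<otimes> a) p"]) simp
  qed
  then show thesis
    using that by blast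
qed

lemma separable_over_residue_iff:
  assumes A: "subring A R" and x: "x \<in> carrier R"
  shows "k.separable_over (residual_subfield A R I) (residue_class R I x \<one>) \<longleftrightarrow> separable_at A I x"
proof
  let ?\<phi> = "\<lambda>a. residue_class R I a \<one>"
  have val: "k.eval (map ?\<phi> p) (?\<phi> x) = ?\<phi> (eval p x)"
      "k.eval (k.poly_deriv (map ?\<phi> p)) (?\<phi> x) = ?\<phi> (eval (poly_deriv p) x)"
      "eval p x \<in> carrier R" "eval (poly_deriv p) x \<in> carrier R" if "set p \<subseteq> A" for p
  proof -
    have p: "set p \<subseteq> carrier R"
      using that subringE(1)[OF A] by blast
    then show "k.eval (map ?\<phi> p) (?\<phi> x) = ?\<phi> (eval p x)"
      "k.eval (k.poly_deriv (map ?\<phi> p)) (?\<phi> x) = ?\<phi> (eval (poly_deriv p) x)"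
      using \<phi>.eval_hom'[OF x p] \<phi>.eval_poly_deriv_hom[OF x p] by simp_all
    show "eval p x \<in> carrier R" "eval (poly_deriv p) x \<in> carrier R"
      using eval_in_carrier x p polynomial_incl[OF poly_deriv_polynomial[OF carrier_is_subring p]] by auto
  qed
  {
    assume "separable_at A I x"
    then obtain p where p: "set p \<subseteq> A" "eval p x \<in> I" "eval (poly_deriv p) x \<notin> I"
      unfolding separable_at_def by blast
    have "set (map ?\<phi> p) \<subseteq> residual_subfield A R I"
      using residue_mem_residual_subfield[OF A] p(1) by auto
    then show "k.separable_over (residual_subfield A R I) (?\<phi> x)"
      unfolding k.separable_over_def
      using p val[OF p(1)] residue_eq_zero_iff by (intro exI[of _ "map ?\<phi> p"]) simp
  next
    assume "k.separable_over (residual_subfield A R I) (?\<phi> x)"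
    then obtain f where f: "set f \<subseteq> residual_subfield A R I" "k.eval f (?\<phi> x) = \<zero>\<^bsub>residue_field R I\<^esub>"
      "k.eval (k.poly_deriv f) (?\<phi> x) \<noteq> \<zero>\<^bsub>residue_field R I\<^esub>"
      unfolding k.separable_over_def by blast
    \<comment> \<open>The residue of s is nonzero and multiplies both f(x) and f'(x), so it does not
      affect whether they vanish.\<close>
    obtain s p where s: "s \<in> A - I" "set p \<subseteq> A" "map ?\<phi> p = map (\<lambda>c. ?\<phi> s \<otimes>\<^bsub>residue_field R I\<^esub> c) f"
      using clear_denominators[OF A f(1)] .
    have fc: "set f \<subseteq> carrier (residue_field R I)"
      using f(1) subfieldE(3)[OF subfield_residual_subfield[OF A]] by blast
    have sc: "s \<in> carrier R"
      using s subringE(1)[OF A] by blast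
    have \<phi>s: "?\<phi> s \<in> carrier (residue_field R I)" "?\<phi> s \<noteq> \<zero>\<^bsub>residue_field R I\<^esub>"
      using sc s(1) residue_eq_zero_iff[OF sc] by auto
    have \<phi>x: "?\<phi> x \<in> carrier (residue_field R I)"
      using x by simp
    have D: "k.eval (k.poly_deriv f) (?\<phi> x) \<in> carrier (residue_field R I)"
      using k.eval_in_carrier[OF _ \<phi>x] k.polynomial_incl[OF k.poly_deriv_polynomial[OF k.carrier_is_subring fc]] .
    have "?\<phi> (eval p x) = \<zero>\<^bsub>residue_field R I\<^esub>"
      using val(1)[OF s(2)] k.eval_scalar[OF \<phi>s(1) fc \<phi>x] f(2) \<phi>s(1) unfolding s(3) by simp
    moreover have "?\<phi> (eval (poly_deriv p) x) \<noteq> \<zero>\<^bsub>residue_field R I\<^esub>"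
      using val(2)[OF s(2)] k.eval_poly_deriv_scalar[OF \<phi>s(1) fc \<phi>x] f(3) \<phi>s D k.integral_iff
      unfolding s(3) by metis
    ultimately show "separable_at A I x"
      unfolding separable_at_def using s(2) val(3,4)[OF s(2)] residue_eq_zero_iff by blast
  }
qed

text \<open>Every residue is a quotient of residues of ring elements, and the separable residues
  form a subfield; so testing ring elements suffices.\<close>

lemma separable_algebraic_residual_iff:
  assumes A: "subring A R"
  shows "separable_algebraic (residual_subfield A R I) (residue_field R I) \<longleftrightarrow>
    (\<forall>x\<in>carrier R. separable_at A I x)"
proof -
  let ?K = "residual_subfield A R I"
  note K = subfield_residual_subfield[OF A]
  have "(\<forall>\<xi>\<in>carrier (residue_field R I). k.separable_over ?K \<xi>) \<longleftrightarrow>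
      (\<forall>x\<in>carrier R. k.separable_over ?K (residue_class R I x \<one>))"
  proof (intro iffI ballI)
    fix \<xi> assume *: "\<forall>x\<in>carrier R. k.separable_over ?K (residue_class R I x \<one>)"
      and "\<xi> \<in> carrier (residue_field R I)"
    then obtain a s where a: "a \<in> carrier R" "s \<in> carrier R - I" "\<xi> = residue_class R I a s"
      unfolding residue_field_carrier by blast
    let ?F = "{\<xi> \<in> carrier (residue_field R I). k.separable_over ?K \<xi>}"
    note F = k.subfield_of_separables[OF K]
    have "residue_class R I a \<one> \<in> ?F" "residue_class R I s \<one> \<in> ?F - {\<zero>\<^bsub>residue_field R I\<^esub>}"
      using a * residue_eq_zero_iff by auto
    then have "residue_class R I a \<one> \<otimes>\<^bsub>residue_field R I\<^esub> inv\<^bsub>residue_field R I\<^esub> residue_class R I s \<one> \<in> ?F"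
      using k.subfield_m_inv(1)[OF F] subringE(6)[OF subfieldE(1)[OF F]] by blast
    then show "k.separable_over ?K \<xi>"
      using residue_class_as_quotient[OF a(1,2)] a(3) by simp
  qed simp
  then show ?thesis
    using k.separable_algebraic_iff[OF K] separable_over_residue_iff[OF A] by simp
qed

text \<open>The set is the preimage of the subfield of separable residues under the residue
  homomorphism.\<close>

lemma subring_separable_at:
  assumes A: "subring A R"
  shows "subring {x \<in> carrier R. separable_at A I x} R"
proof -
  let ?F = "{\<xi> \<in> carrier (residue_field R I). k.separable_over (residual_subfield A R I) \<xi>}"
  note F = subringE[OF subfieldE(1)[OF k.subfield_of_separables[OF subfield_residual_subfield[OF A]]]]
  have eq: "separable_at A I x \<longleftrightarrow> residue_class R I x \<one> \<in> ?F" if "x \<in> carrier R" for x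
    using separable_over_residue_iff[OF A that] that by simp
  show ?thesis
  proof (rule subringI)
    show "\<one> \<in> {x \<in> carrier R. separable_at A I x}"
      using F(3) eq[of \<one>] by (simp flip: residue_class_one)
  next
    fix x assume "x \<in> {x \<in> carrier R. separable_at A I x}"
    then show "\<ominus> x \<in> {x \<in> carrier R. separable_at A I x}"
      using eq[of x] eq[of "\<ominus> x"] F(5)[of "residue_class R I x \<one>"] by simp
  next
    fix x y assume "x \<in> {x \<in> carrier R. separable_at A I x}" "y \<in> {x \<in> carrier R. separable_at A I x}"
    then show "x \<otimes> y \<in> {x \<in> carrier R. separable_at A I x}" "x \<oplus> y \<in> {x \<in> carrier R. separable_at A I x}"
      using eq[of x] eq[of y] eq[of "x \<otimes> y"] eq[of "x \<oplus> y"]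
        F(6,7)[of "residue_class R I x \<one>" "residue_class R I y \<one>"] by simp_all
  qed auto
qed

lemma separable_at_base:
  assumes "subring A R" "a \<in> A"
  shows "separable_at A I a"
  using separable_over_residue_iff[OF assms(1)] subringE(1)[OF assms(1)] assms(2)
    k.separable_over_base[OF subfield_residual_subfield[OF assms(1)]]
    residue_mem_residual_subfield[OF assms] by blast

end

section \<open>Intermediate rings and their primes\<close>

lemma integral_extension_subring:
  fixes S :: "('a, 'b) ring_scheme"
  assumes "ring S" "subring W S" "R \<subseteq> W" "integral_extension R S"
  shows "integral_extension R (S\<lparr>carrier := W\<rparr>)"
proof -
  interpret ring S by fact
  show ?thesis
    using assms(4) subringE(1)[OF assms(2)] eval_consistent[OF assms(2)]
    unfolding integral_extension_def by auto
qed

lemma integral_extension_mono: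
  "integral_extension R S \<Longrightarrow> R \<subseteq> W \<Longrightarrow> integral_extension W S"
  unfolding integral_extension_def by blast

text \<open>The left side tests the primes of \<open>W\<close>, the right side those of the whole
  ring. Contraction maps the latter to the former, and lying over for the integral extension of
  \<open>W\<close> makes this map surjective.\<close>

lemma (in cring) kappa_separable_iff:
  assumes A: "subring A R" and W: "subring W R" "A \<subseteq> W" and int: "integral_extension A R"
  shows "kappa_separable A (R\<lparr>carrier := W\<rparr>) \<longleftrightarrow>
    (\<forall>x\<in>W. \<forall>Q. primeideal Q R \<longrightarrow> separable_at A Q x)"
proof -
  let ?W = "R\<lparr>carrier := W\<rparr>"
  interpret W: ring ?W
    by (rule subring_is_ring[OF W(1)])
  have AW: "subring A ?W"
    using A W ring.subring_iff[OF W.ring_axioms, of A] subring_iff[OF subringE(1)[OF A]] by simp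
  have "kappa_separable A ?W \<longleftrightarrow> (\<forall>Q'. primeideal Q' ?W \<longrightarrow> (\<forall>x\<in>W. W.separable_at A Q' x))"
    unfolding kappa_separable_def
    using integral_extension_subring[OF ring_axioms W int]
      primeideal.separable_algebraic_residual_iff[OF _ AW] by auto
  also have "\<dots> \<longleftrightarrow> (\<forall>Q. primeideal Q R \<longrightarrow> (\<forall>x\<in>W. separable_at A Q x))"
  proof (intro iffI allI impI ballI)
    fix Q x assume *: "\<forall>Q'. primeideal Q' ?W \<longrightarrow> (\<forall>x\<in>W. W.separable_at A Q' x)"
      and "primeideal Q R" "x \<in> W"
    then show "separable_at A Q x"
      using primeideal.primeideal_contract[OF _ W(1), of Q] separable_at_subring[OF W, of x Q] by blast
  next
    fix Q' x assume *: "\<forall>Q. primeideal Q R \<longrightarrow> (\<forall>x\<in>W. separable_at A Q x)"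
      and Q': "primeideal Q' ?W" and x: "x \<in> W"
    obtain Q where "primeideal Q R" "Q \<inter> W = Q'"
      using lying_over[OF W(1) integral_extension_mono[OF int W(2)] Q'] .
    then show "W.separable_at A Q' x"
      using * x separable_at_subring[OF W, of x Q] by blast
  qed
  finally show ?thesis by blast
qed

section \<open>Powers of integral elements and radiciality\<close>

context primeideal
begin

interpretation k: field "residue_field R I"
  by (rule residue_field_field)

interpretation \<phi>: ring_hom_ring R "residue_field R I" "\<lambda>a. residue_class R I a \<one>"
  by (rule residue_hom)

text \<open>The leading coefficient stays 1 in the residue field, so a single degree bound serves at
  all primes.\<close>

lemma residue_root_of_monic:
  assumes A: "subring A R" and x: "x \<in> carrier R"
    and p: "set p \<subseteq> A" "p \<noteq> []" "lead_coeff p = \<one>" "eval p x = \<zero>"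
  shows "map (\<lambda>a. residue_class R I a \<one>) p \<in> carrier ((residual_subfield A R I)[X]\<^bsub>residue_field R I\<^esub>)"
    and "k.eval (map (\<lambda>a. residue_class R I a \<one>) p) (residue_class R I x \<one>) = \<zero>\<^bsub>residue_field R I\<^esub>"
proof -
  have "set p \<subseteq> carrier R"
    using p(1) subringE(1)[OF A] by blast
  then show "k.eval (map (\<lambda>a. residue_class R I a \<one>) p) (residue_class R I x \<one>) = \<zero>\<^bsub>residue_field R I\<^esub>"
    using \<phi>.eval_hom'[OF x, of p] p(4) by simp
  show "map (\<lambda>a. residue_class R I a \<one>) p \<in> carrier ((residual_subfield A R I)[X]\<^bsub>residue_field R I\<^esub>)"
    using p residue_mem_residual_subfield[OF A] \<phi>.hom_one
      subringE(3)[OF subfieldE(1)[OF subfield_residual_subfield[OF A]]]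
    by (cases p) (auto simp: polynomial_def simp flip: univ_poly_carrier)
qed

text \<open>The factor \<open>s\<close> kills the residue of \<open>x\<close> at the primes of small positive residue characteristic
  different from \<open>c\<close>; at the other ones, either the \<open>(c ^ n)\<close>-th power or \<open>x\<close> itself is separable.\<close>

lemma separable_at_multiple_of_power:
  assumes A: "subring A R" and x: "x \<in> carrier R"
    and p: "set p \<subseteq> A" "p \<noteq> []" "lead_coeff p = \<one>" "eval p x = \<zero>" and n: "degree p \<le> n"
    and c: "c = 0 \<or> Factorial_Ring.prime c" and e: "c \<noteq> 0 \<Longrightarrow> e = c"
  shows "separable_at A I ([(\<Prod>{i\<in>{1..degree p}. \<not> c dvd i})] \<cdot> (x [^] (e ^ n)))"
proof -
  let ?K = "residual_subfield A R I" and ?\<phi> = "\<lambda>a. residue_class R I a \<one>"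
  \<comment> \<open>For \<open>c = 0\<close> no index is excluded and \<open>?s\<close> is the
    factorial of the degree.\<close>
  let ?s = "\<Prod>{i\<in>{1..degree p}. \<not> c dvd i}" and ?c = "group.ord (add_monoid (residue_field R I)) \<one>\<^bsub>residue_field R I\<^esub>"
  note K = subfield_residual_subfield[OF A]
  note f = residue_root_of_monic[OF A x p]
  have f0: "map ?\<phi> p \<noteq> []" "degree (map ?\<phi> p) = degree p"
    using p(2) by auto
  have \<phi>x: "?\<phi> x \<in> carrier (residue_field R I)"
    using x by simp
  note F = subringE[OF subring_separable_at[OF A]]
  have mult: "[(m::nat)] \<cdot> y \<in> {x \<in> carrier R. separable_at A I x}"
    if "y \<in> {x \<in> carrier R. separable_at A I x}" for m y
    using that F(2,7) by (induction m) auto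
  have y: "x [^] (e ^ n) \<in> carrier R"
    using x by simp
  have \<phi>y: "?\<phi> (x [^] (e ^ n)) = ?\<phi> x [^]\<^bsub>residue_field R I\<^esub> (e ^ n)"
    using x by (simp add: \<phi>.hom_nat_pow)
  consider (large) "?c = 0 \<or> degree p < ?c" | (same) "?c = c" "?c \<noteq> 0" | (small) "?c \<noteq> 0" "?c \<le> degree p" "?c \<noteq> c"
    by linarith
  then show ?thesis
  proof cases
    case large
    then have "k.separable_over ?K (?\<phi> x)"
      using k.separable_over_of_degree_less_characteristic[OF subfieldE(1)[OF K] \<phi>x f(1) f0(1) f(2)] f0(2)
      by simp
    then have "k.separable_over ?K (?\<phi> (x [^] (e ^ n)))"
      unfolding \<phi>y using k.separable_over_nat_pow[OF K \<phi>x] by blast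
    then have "separable_at A I (x [^] (e ^ n))"
      using separable_over_residue_iff[OF A y] by simp
    then show ?thesis
      using mult[of "x [^] (e ^ n)" ?s] y by simp
  next
    case same
    then have "k.separable_over ?K (?\<phi> (x [^] (e ^ n)))"
      using k.separable_over_characteristic_pow[OF K \<phi>x refl _ f(1) f0(1) f(2), of n] f0(2) n e
      unfolding \<phi>y by simp
    then have "separable_at A I (x [^] (e ^ n))"
      using separable_over_residue_iff[OF A y] by simp
    then show ?thesis
      using mult[of "x [^] (e ^ n)" ?s] y by simp
  next
    case small
    have pr: "Factorial_Ring.prime ?c"
      by (rule k.characteristic_cases) (use small(1) in auto)
    \<comment> \<open>So the prime \<open>?c\<close> is itself one of the factors of
      \<open>?s\<close>. For \<open>c = 0\<close> the claim holds because 0 divides only 0.\<close>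
    have "\<not> c dvd ?c"
      using c small pr primes_dvd_imp_eq by auto
    then have "?c dvd ?s"
      using small pr prime_gt_0_nat by (intro dvd_prodI[where f = "\<lambda>i. i"]) (auto simp: Suc_le_eq)
    then have "[?s] \<cdot>\<^bsub>residue_field R I\<^esub> \<one>\<^bsub>residue_field R I\<^esub> = \<zero>\<^bsub>residue_field R I\<^esub>"
      using k.add_pow_one_eq_zero_iff by blast
    moreover have "?\<phi> ([?s] \<cdot> (x [^] (e ^ n))) = [?s] \<cdot>\<^bsub>residue_field R I\<^esub> ?\<phi> (x [^] (e ^ n))"
      using \<phi>.hom_add_pow_nat[OF y] .
    moreover have "\<dots> = [?s] \<cdot>\<^bsub>residue_field R I\<^esub> \<one>\<^bsub>residue_field R I\<^esub> \<otimes>\<^bsub>residue_field R I\<^esub> ?\<phi> (x [^] (e ^ n))"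
      using k.add_pow_eq_mult[of "?\<phi> (x [^] (e ^ n))" ?s] y by simp
    ultimately have "?\<phi> ([?s] \<cdot> (x [^] (e ^ n))) = \<zero>\<^bsub>residue_field R I\<^esub>"
      using y \<phi>.hom_closed[OF y] by simp
    then have "k.separable_over ?K (?\<phi> ([?s] \<cdot> (x [^] (e ^ n))))"
      using k.separable_over_base[OF K] subringE(2)[OF subfieldE(1)[OF K]] by simp
    then show ?thesis
      using separable_over_residue_iff[OF A, of "[?s] \<cdot> (x [^] (e ^ n))"] y by simp
  qed
qed

lemma purely_inseparable_residual:
  assumes A: "subring A R" and int: "integral_extension A R"
    and Z: "subring Z R" "{x \<in> carrier R. \<forall>Q. primeideal Q R \<longrightarrow> separable_at A Q x} \<subseteq> Z"
  shows "purely_inseparable (residual_subfield Z R I) (residue_field R I)"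
proof -
  let ?K = "residual_subfield Z R I" and ?\<phi> = "\<lambda>a. residue_class R I a \<one>"
  let ?e = "char_exponent (residue_field R I)"
  define c where "c = group.ord (add_monoid (residue_field R I)) \<one>\<^bsub>residue_field R I\<^esub>"
  note K = subfield_residual_subfield[OF Z(1)]
  \<comment> \<open>For \<open>c = 0\<close> the exponent \<open>?e\<close> is 1, and the powers
    below are first powers.\<close>
  have e: "c \<noteq> 0 \<Longrightarrow> ?e = c"
    unfolding char_exponent_def c_def by (simp add: Let_def)
  have c: "c = 0 \<or> Factorial_Ring.prime c"
    unfolding c_def using k.characteristic_cases by blast
  \<comment> \<open>All large exponents are covered, because the numerator and the denominator of a
    residue will need a common one.\<close>
  have pow: "\<exists>d. \<forall>n\<ge>d. ?\<phi> x [^]\<^bsub>residue_field R I\<^esub> (?e ^ n) \<in> ?K" if x: "x \<in> carrier R" for x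
  proof -
    obtain p where p: "set p \<subseteq> A" "p \<noteq> []" "lead_coeff p = \<one>" "eval p x = \<zero>"
      using int x unfolding integral_extension_def by blast
    have "?\<phi> x [^]\<^bsub>residue_field R I\<^esub> (?e ^ n) \<in> ?K" if n: "n \<ge> degree p" for n
    proof -
      define s where "s = \<Prod>{i\<in>{1..degree p}. \<not> c dvd i}"
      define y where "y = x [^] (?e ^ n)"
      have y: "y \<in> carrier R"
        using x by (simp add: y_def)
      have "[s] \<cdot> y \<in> Z"
        using primeideal.separable_at_multiple_of_power[OF _ A x p n c e] Z(2) y
        unfolding s_def y_def by auto
      then have "?\<phi> ([s] \<cdot> y) \<in> ?K"
        by (rule residue_mem_residual_subfield[OF Z(1)])
      also have "?\<phi> ([s] \<cdot> y) =
          [s] \<cdot>\<^bsub>residue_field R I\<^esub> \<one>\<^bsub>residue_field R I\<^esub> \<otimes>\<^bsub>residue_field R I\<^esub> ?\<phi> y"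
        using \<phi>.hom_add_pow_nat[OF y, of s] k.add_pow_eq_mult[of "?\<phi> y" s] y by simp
      finally have mem: "[s] \<cdot>\<^bsub>residue_field R I\<^esub> \<one>\<^bsub>residue_field R I\<^esub> \<otimes>\<^bsub>residue_field R I\<^esub> ?\<phi> y \<in> ?K" .
      \<comment> \<open>For \<open>c = 0\<close> this means that s is nonzero; for a prime
        \<open>c\<close> it holds because no factor of s is divisible by \<open>c\<close>. Either
        way s can be cancelled in \<open>?K\<close>.\<close>
      have "\<not> c dvd s"
      proof (cases "c = 0")
        case True
        then show ?thesis unfolding s_def by auto
      next
        case False
        then have "Factorial_Ring.prime c" using c by simp
        then show ?thesis unfolding s_def by (subst prime_dvd_prod_iff) auto
      qed
      then have "[s] \<cdot>\<^bsub>residue_field R I\<^esub> \<one>\<^bsub>residue_field R I\<^esub> \<noteq> \<zero>\<^bsub>residue_field R I\<^esub>"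
        using k.add_pow_one_eq_zero_iff[of s] by (simp add: c_def)
      moreover have "[s] \<cdot>\<^bsub>residue_field R I\<^esub> \<one>\<^bsub>residue_field R I\<^esub> \<in> ?K"
        using subringE(2,3,7)[OF subfieldE(1)[OF K]] by (induction s) auto
      ultimately have "?\<phi> y \<in> ?K"
        using k.subfield_m_inv_simprule[OF K _ _ mem] y by simp
      then show ?thesis
        unfolding y_def using x by (simp add: \<phi>.hom_nat_pow)
    qed
    then show ?thesis by blast
  qed
  show ?thesis
    unfolding purely_inseparable_def
  proof
    fix \<xi> assume "\<xi> \<in> carrier (residue_field R I)"
    then obtain a t where a: "a \<in> carrier R" "t \<in> carrier R - I" "\<xi> = residue_class R I a t"
      unfolding residue_field_carrier by blast
    have tc: "t \<in> carrier R"
      using a by simp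
    obtain d d' where d: "\<And>n. n \<ge> d \<Longrightarrow> ?\<phi> a [^]\<^bsub>residue_field R I\<^esub> (?e ^ n) \<in> ?K"
      "\<And>n. n \<ge> d' \<Longrightarrow> ?\<phi> t [^]\<^bsub>residue_field R I\<^esub> (?e ^ n) \<in> ?K"
      using pow[OF a(1)] pow[OF tc] by blast
    let ?N = "?e ^ max d d'"
    have \<xi>: "\<xi> \<in> carrier (residue_field R I)"
      using a residue_class_closed by simp
    have \<phi>t: "?\<phi> t \<in> carrier (residue_field R I)" "?\<phi> t \<noteq> \<zero>\<^bsub>residue_field R I\<^esub>"
      using a residue_eq_zero_iff by auto
    \<comment> \<open>Raised to the power \<open>?N\<close>, this exhibits the power of \<xi> as a
      quotient of two elements of \<open>?K\<close>.\<close>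
    have "?\<phi> t \<otimes>\<^bsub>residue_field R I\<^esub> \<xi> = ?\<phi> a"
      unfolding a(3) residue_class_as_quotient[OF a(1,2)]
      using \<phi>t a(1) k.field_Units by (metis DiffI \<phi>.hom_closed empty_iff insert_iff k.Units_closed
          k.Units_inv_closed k.Units_r_inv k.m_lcomm k.r_one)
    then have mem: "?\<phi> t [^]\<^bsub>residue_field R I\<^esub> ?N \<otimes>\<^bsub>residue_field R I\<^esub> \<xi> [^]\<^bsub>residue_field R I\<^esub> ?N \<in> ?K"
      using d(1)[of "max d d'"] k.nat_pow_distrib[OF \<phi>t(1) \<xi>, of ?N] by simp
    have "?\<phi> t [^]\<^bsub>residue_field R I\<^esub> m \<noteq> \<zero>\<^bsub>residue_field R I\<^esub>" for m :: nat
      using \<phi>t k.integral_iff by (induction m) auto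
    then have "?\<phi> t [^]\<^bsub>residue_field R I\<^esub> ?N \<in> ?K - {\<zero>\<^bsub>residue_field R I\<^esub>}"
      using d(2)[OF max.cobounded2] by blast
    then have "\<xi> [^]\<^bsub>residue_field R I\<^esub> ?N \<in> ?K"
      by (rule k.subfield_m_inv_simprule[OF K _ k.nat_pow_closed[OF \<xi>] mem])
    then show "\<exists>n. \<xi> [^]\<^bsub>residue_field R I\<^esub> (?e ^ n) \<in> ?K"
      by blast
  qed
qed

end

section \<open>The greatest kappa-separable subalgebra\<close>

theorem theorem4p12:
  fixes S :: "('a, 'b) ring_scheme" and R :: "'a set"
  assumes "cring S"
    and "subcring R S"
    and "R \<subset> carrier S"
    and "integral_extension R S"
    and "FCP R S"
  shows "\<exists>V \<in> subalgebras R S.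
      kappa_separable R (S\<lparr>carrier := V\<rparr>) \<and>
      (\<forall>W \<in> subalgebras R S. kappa_separable R (S\<lparr>carrier := W\<rparr>) \<longrightarrow> W \<subseteq> V) \<and>
      (\<forall>U \<in> subalgebras R S.
        kappa_separable R (S\<lparr>carrier := U\<rparr>) \<longleftrightarrow> U \<in> subalgebras R (S\<lparr>carrier := V\<rparr>)) \<and>
      (\<forall>Z \<in> subalgebras V S. kappa_radicial Z S)"
proof -
  interpret S: cring S by fact
  have R: "subring R S"
    using assms(2) by (simp add: subcring_def)
  define V where "V = {x \<in> carrier S. \<forall>Q. primeideal Q S \<longrightarrow> S.separable_at R Q x}"
  note F = subringE[OF primeideal.subring_separable_at[OF _ R]]
  \<comment> \<open>\<open>V\<close> is an intersection of subrings, one for each prime of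
    \<open>S\<close>.\<close>
  have "subring V S"
  proof (rule S.subringI)
    show "V \<subseteq> carrier S" by (auto simp: V_def)
    show "\<one>\<^bsub>S\<^esub> \<in> V"
      using F(3) by (auto simp: V_def)
  next
    fix x assume "x \<in> V"
    then show "\<ominus>\<^bsub>S\<^esub> x \<in> V"
      using F(5) by (auto simp: V_def)
  next
    fix x y assume "x \<in> V" "y \<in> V"
    then show "x \<otimes>\<^bsub>S\<^esub> y \<in> V" "x \<oplus>\<^bsub>S\<^esub> y \<in> V"
      using F(6,7) by (auto simp: V_def)
  qed
  moreover have "R \<subseteq> V"
    using primeideal.separable_at_base[OF _ R] subringE(1)[OF R] by (auto simp: V_def)
  ultimately have V: "V \<in> subalgebras R S"
    unfolding subalgebras_def by (simp add: S.subcringI')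
  \<comment> \<open>The case W = V is the separability of \<open>V\<close>. In general this makes
    \<open>V\<close> the greatest such subalgebra and, with \<open>sub\<close>, gives the
    equivalence for U.\<close>
  have sep: "kappa_separable R (S\<lparr>carrier := W\<rparr>) \<longleftrightarrow> W \<subseteq> V" if "W \<in> subalgebras R S" for W
  proof -
    have W: "subring W S" "R \<subseteq> W"
      using that by (auto simp: subalgebras_def subcring_def)
    then show ?thesis
      using S.kappa_separable_iff[OF R W assms(4)] subringE(1)[OF W(1)] by (auto simp: V_def)
  qed
  have sub: "U \<subseteq> V \<longleftrightarrow> U \<in> subalgebras R (S\<lparr>carrier := V\<rparr>)" if U: "U \<in> subalgebras R S" for U
  proof -
    interpret V: ring "S\<lparr>carrier := V\<rparr>"
      by (rule S.subring_is_ring[OF \<open>subring V S\<close>])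
    have "subcring U (S\<lparr>carrier := V\<rparr>)" if "U \<subseteq> V"
      using U that V.subcring_iff[of U] S.subcring_iff[of U] subcringE(1)[of U S]
      by (simp add: subalgebras_def)
    moreover have "U \<subseteq> V" if "subcring U (S\<lparr>carrier := V\<rparr>)"
      using subcringE(1)[OF that] by simp
    ultimately show ?thesis
      using U by (auto simp: subalgebras_def)
  qed
  have "kappa_radicial Z S" if "Z \<in> subalgebras V S" for Z
  proof -
    have Z: "subring Z S" "V \<subseteq> Z"
      using that by (auto simp: subalgebras_def subcring_def)
    then show ?thesis
      unfolding kappa_radicial_def
      using primeideal.purely_inseparable_residual[OF _ R assms(4) Z(1)]
        integral_extension_mono[OF assms(4)] \<open>R \<subseteq> V\<close> by (auto simp: V_def)
  qed
  then show ?thesis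
    using V sep sub by blast
qed

end
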